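(* Let $H$ be a group acting freely on a nonempty median set $\mathbb{X}$. Then there exists a group $\mathfrak{H}$ acting freely and transitively on a median set $\mathfrak{X}$, together with an embedding $(\iota_0,\iota):(H,\mathbb{X})\to(\mathfrak{H},\mathfrak{X})$ in the category FAMS (i.e. a morphism in FAMS with $\iota_0$ and $\iota$ injective) such that the following universal property is satisfied. (TUP) For every group $\widetilde{H}$ acting freely and transitively on a median set $\widetilde{\mathbb{X}}$ and for every morphism $(\psi_0,\psi):(H,\mathbb{X})\to(\widetilde{H},\widetilde{\mathbb{X}})$ in FAMS, there exists a unique morphism $(\Psi_0,\Psi):(\mathfrak{H},\mathfrak{X})\to(\widetilde{H},\widetilde{\mathbb{X}})$ in FTAMS such that $\Psi_0\circ\iota_0=\psi_0$ and $\Psi\circ\iota=\psi$.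
   Context: A median set is a set $X$ with a map $m:X^3\to X$ such that (M1) $m(x,y,z)=m(y,x,z)=m(x,z,y)$; (M2) $m(x,y,x)=x$; (M3) $m(m(x,y,z),u,v)=m(m(x,u,v),m(y,u,v),z)$. Morphisms of median sets are the maps preserving $m$. An action (from the left) of a group $G$ on a median set $(X,m)$ is an action on the set $X$ with $g\cdot m(x,y,z)=m(g\cdot x,g\cdot y,g\cdot z)$; it is free if $g\cdot x=x$ for some $x\in X$ implies $g=1$. FAMS is the category whose objects are pairs $(G,\mathbb{X})$ with $G$ a group acting freely on a nonempty median set $\mathbb{X}$, and whose morphisms $(G,\mathbb{X})\to(G',\mathbb{X}')$ are pairs $(\psi_0,\psi)$ with $\psi_0:G\to G'$ a group morphism and $\psi:\mathbb{X}\to\mathbb{X}'$ a morphism of median sets such that $\psi(g\cdot x)=\psi_0(g)\cdot\psi(x)$ for all $g\in G$, $x\in X$. FTAMS is the full subcategory of FAMS consisting of the free and transitive actions on nonempty median sets. *)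

theory Defs
  imports "HOL-Algebra.Group_Action"
begin

locale median_set =
  fixes X :: "'x set" and m :: "'x \<Rightarrow> 'x \<Rightarrow> 'x \<Rightarrow> 'x"
  assumes median_closed: "\<lbrakk>x \<in> X; y \<in> X; z \<in> X\<rbrakk> \<Longrightarrow> m x y z \<in> X"
    and M1_left: "\<lbrakk>x \<in> X; y \<in> X; z \<in> X\<rbrakk> \<Longrightarrow> m x y z = m y x z"
    and M1_right: "\<lbrakk>x \<in> X; y \<in> X; z \<in> X\<rbrakk> \<Longrightarrow> m x y z = m x z y"
    and M2: "\<lbrakk>x \<in> X; y \<in> X\<rbrakk> \<Longrightarrow> m x y x = x"
    and M3: "\<lbrakk>x \<in> X; y \<in> X; z \<in> X; u \<in> X; v \<in> X\<rbrakk>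
      \<Longrightarrow> m (m x y z) u v = m (m x u v) (m y u v) z"

definition median_hom ::
  "'x set \<Rightarrow> ('x \<Rightarrow> 'x \<Rightarrow> 'x \<Rightarrow> 'x) \<Rightarrow> 'y set \<Rightarrow> ('y \<Rightarrow> 'y \<Rightarrow> 'y \<Rightarrow> 'y) \<Rightarrow> ('x \<Rightarrow> 'y) set"
  where "median_hom X m Y n =
    {f \<in> X \<rightarrow> Y. \<forall>x\<in>X. \<forall>y\<in>X. \<forall>z\<in>X. f (m x y z) = n (f x) (f y) (f z)}"

record ('g, 'x) median_action =
  grp :: "'g monoid"
  pts :: "'x set"
  med :: "'x \<Rightarrow> 'x \<Rightarrow> 'x \<Rightarrow> 'x"
  act :: "'g \<Rightarrow> 'x \<Rightarrow> 'x"

definition fams :: "('g, 'x) median_action \<Rightarrow> bool"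
  where "fams A \<longleftrightarrow>
    median_set (pts A) (med A) \<and> pts A \<noteq> {} \<and>
    group_action (grp A) (pts A) (act A) \<and>
    (\<forall>g\<in>carrier (grp A). \<forall>x\<in>pts A. \<forall>y\<in>pts A. \<forall>z\<in>pts A.
      act A g (med A x y z) = med A (act A g x) (act A g y) (act A g z)) \<and>
    (\<forall>g\<in>carrier (grp A). (\<exists>x\<in>pts A. act A g x = x) \<longrightarrow> g = \<one>\<^bsub>grp A\<^esub>)"

definition ftams :: "('g, 'x) median_action \<Rightarrow> bool"
  where "ftams A \<longleftrightarrow> fams A \<and> transitive_action (grp A) (pts A) (act A)"

text \<open>The two components of a morphism are taken to be extensional, i.e. to have the value
  \<^const>\<open>undefined\<close> outside the carriers, so that equality of morphisms is equality of maps on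
  the carriers and \<open>\<exists>!\<close> has its intended meaning.\<close>

definition fams_hom ::
  "('g, 'x) median_action \<Rightarrow> ('h, 'y) median_action \<Rightarrow> (('g \<Rightarrow> 'h) \<times> ('x \<Rightarrow> 'y)) set"
  where "fams_hom A B = {(f\<^sub>0, f).
    f\<^sub>0 \<in> hom (grp A) (grp B) \<inter> extensional (carrier (grp A)) \<and>
    f \<in> median_hom (pts A) (med A) (pts B) (med B) \<inter> extensional (pts A) \<and>
    (\<forall>g\<in>carrier (grp A). \<forall>x\<in>pts A. f (act A g x) = act B (f\<^sub>0 g) (f x))}"

definition fams_embedding ::
  "('g, 'x) median_action \<Rightarrow> ('h, 'y) median_action \<Rightarrow> ('g \<Rightarrow> 'h) \<times> ('x \<Rightarrow> 'y) \<Rightarrow> bool"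
  where "fams_embedding A B = (\<lambda>(i\<^sub>0, i). (i\<^sub>0, i) \<in> fams_hom A B \<and>
    inj_on i\<^sub>0 (carrier (grp A)) \<and> inj_on i (pts A))"

text \<open>\<open>tup A W (i\<^sub>0, i) K\<close> is the universal property of \<open>(i\<^sub>0, i) : A \<rightarrow> W\<close> with respect to a
  single free and transitive target \<open>K\<close>.\<close>

definition tup ::
  "('g, 'x) median_action \<Rightarrow> ('h, 'y) median_action \<Rightarrow> ('g \<Rightarrow> 'h) \<times> ('x \<Rightarrow> 'y)
    \<Rightarrow> ('k, 'z) median_action \<Rightarrow> bool"
  where "tup A W = (\<lambda>(i\<^sub>0, i) K. \<forall>(p\<^sub>0, p) \<in> fams_hom A K.
    \<exists>!(P\<^sub>0, P). (P\<^sub>0, P) \<in> fams_hom W K \<and>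
      compose (carrier (grp A)) P\<^sub>0 i\<^sub>0 = p\<^sub>0 \<and> compose (pts A) P i = p)"

text \<open>A formula of HOL cannot quantify over types, so the universal property against targets in
  all types cannot be written below an existential quantifier. A universal object is generated by
  the image of \<open>A\<close>, hence its group and its set of points have at most as many elements as the
  following type, which serves as the universe in which such objects are sought. In
  \<open>tup_envelope\<close> the targets range over the same universe; that the resulting property extends to
  targets in arbitrary types has to be asserted separately.\<close>

type_synonym ('g, 'x) universe = "('g + 'x + nat) list"

definition tup_envelope ::
  "('g, 'x) median_action \<Rightarrow> (('g, 'x) universe, ('g, 'x) universe) median_action
    \<Rightarrow> ('g \<Rightarrow> ('g, 'x) universe) \<times> ('x \<Rightarrow> ('g, 'x) universe) \<Rightarrow> bool"
  where "tup_envelope A W i \<longleftrightarrow> ftams W \<and> fams_embedding A W i \<and>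
    (\<forall>K :: (('g, 'x) universe, ('g, 'x) universe) median_action. ftams K \<longrightarrow> tup A W i K)"

end

theory Submission
  imports Defs
begin

text \<open>
  After the choice of a base point, a free and transitive action on a median set is the action by
  left translations of a median group, that is, of a group with a left-invariant median operation.
  Median groups are defined by equations, so a universal one can be presented by generators and
  relations. Fix \<open>b \<in> X\<close>. A morphism from \<open>(H, X)\<close> to a median group that sends \<open>b\<close> to the
  identity is determined by its map \<open>q\<close> on points, because \<open>h\<close> must go to \<open>q (h b)\<close>, and the maps
  \<open>q\<close> that occur are those with \<open>q b = 1\<close> and \<open>q (h x) = q (h b) q x\<close> that preserve medians. The
  envelope is the median group generated by \<open>X\<close> subject to these relations. Its universal property
  against all targets is the evaluation of terms (\<open>tup_envelope_unit\<close>); its elements are normal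
  forms, coded as words, so that it lives in the prescribed universe.

  Generators and relations do not show that \<open>X\<close> is embedded. By universality it suffices to embed
  \<open>(H, X)\<close> into one median group (\<open>fams_embeds_in_median_group\<close>). Let \<open>S\<close> be a set of
  representatives of the \<open>H\<close>-orbits. The pairs \<open>[x, y]\<close> of points modulo the diagonal action of
  \<open>H\<close>, composed by \<open>[x, y] [y, z] = [x, z]\<close>, form the groupoid \<open>S \<times> H \<times> S\<close>. Its universal group
  \<open>G\<close> consists of the reduced words of arrows. Think of \<open>G\<close> as a tree of copies of \<open>X\<close>: every
  \<open>g\<close> lies, for every \<open>x\<close>, on the copy of all \<open>g [x, y]\<close>, and distinct copies share at most one
  point. Sending a word to the point where it leaves a given copy gives a map from \<open>G\<close> to \<open>X\<close>, and
  these maps are used as coordinates on \<open>G\<close>. A reduced path moves each coordinate at most once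
  (\<open>proj_changes_once\<close>), because it enters and leaves a copy only once. It follows that any three
  words have a median computed coordinatewise (\<open>median_with_origin\<close>). The median axioms of \<open>G\<close> are
  then inherited from \<open>X\<close>, and the median is left-invariant because translations permute the
  coordinates. The embedding is \<open>x \<mapsto> [b, x]\<close>.

  The tree is not itself universal. If \<open>X\<close> has two points and \<open>H\<close> is trivial, it is the line of
  integers, on which \<open>1\<close> lies between \<open>0\<close> and \<open>2\<close>. An extension of the bijection from \<open>X\<close> to the
  group of order two would send \<open>0\<close> and \<open>2\<close> to one point and \<open>1\<close> to the other, which is
  impossible for a median morphism.

  Finally, a second universal arrow in the same universe is isomorphic to the envelope, and the
  universal property for targets in other types passes along this isomorphism
  (\<open>tup_transfer\<close>).
\<close>

section \<open>Free actions and median groups\<close>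

lemma (in median_set) majority:
  assumes "x \<in> X" "y \<in> X"
  shows "m x y x = x" "m x x y = x" "m y x x = x"
  using assms M2 M1_left M1_right by metis+

locale free_median_action = median_set X m + group H + group_action H X \<phi>
  for H :: "'h monoid" (structure) and X :: "'x set" and m and \<phi> +
  assumes nonempty: "X \<noteq> {}"
    and act_med: "\<lbrakk>g \<in> carrier H; x \<in> X; y \<in> X; z \<in> X\<rbrakk>
      \<Longrightarrow> \<phi> g (m x y z) = m (\<phi> g x) (\<phi> g y) (\<phi> g z)"
    and free: "\<lbrakk>g \<in> carrier H; x \<in> X; \<phi> g x = x\<rbrakk> \<Longrightarrow> g = \<one>"

lemma fams_iff: "fams A \<longleftrightarrow> free_median_action (grp A) (pts A) (med A) (act A)"
proof -
  have "group (grp A)" if "group_action (grp A) (pts A) (act A)"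
    using that group_action.group_hom group_hom.axioms(1) by blast
  then show ?thesis
    unfolding fams_def free_median_action_def free_median_action_axioms_def by blast
qed

context free_median_action
begin

lemma act_in: "\<lbrakk>g \<in> carrier H; x \<in> X\<rbrakk> \<Longrightarrow> \<phi> g x \<in> X"
  using element_image by blast

lemma act_one: "x \<in> X \<Longrightarrow> \<phi> \<one> x = x"
  using id_eq_one by (metis restrict_apply')

lemma act_mult: "\<lbrakk>g \<in> carrier H; h \<in> carrier H; x \<in> X\<rbrakk> \<Longrightarrow> \<phi> (g \<otimes> h) x = \<phi> g (\<phi> h x)"
  using composition_rule by blast

lemma act_cancel:
  assumes "g \<in> carrier H" "h \<in> carrier H" "x \<in> X" "\<phi> g x = \<phi> h x"
  shows "g = h"
proof -
  have "\<phi> (inv h \<otimes> g) x = \<phi> (inv h \<otimes> h) x"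
    using assms act_mult by (metis inv_closed)
  also have "\<dots> = x"
    using assms by (simp add: act_one)
  finally have "inv h \<otimes> g = \<one>"
    using assms free by blast
  then show ?thesis
    using assms by (metis inv_closed inv_equality inv_inv)
qed

lemma act_inv_act: "\<lbrakk>g \<in> carrier H; x \<in> X\<rbrakk> \<Longrightarrow> \<phi> (inv g) (\<phi> g x) = x"
  using act_mult[of "inv g" g x] act_one by simp

end

locale median_group = group G + median_set "carrier G" m for G (structure) and m +
  assumes left_invariant: "\<lbrakk>g \<in> carrier G; x \<in> carrier G; y \<in> carrier G; z \<in> carrier G\<rbrakk>
      \<Longrightarrow> g \<otimes> m x y z = m (g \<otimes> x) (g \<otimes> y) (g \<otimes> z)"

definition regular_action ::
  "'g monoid \<Rightarrow> ('g \<Rightarrow> 'g \<Rightarrow> 'g \<Rightarrow> 'g) \<Rightarrow> ('g, 'g) median_action"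
  where "regular_action G m = \<lparr>grp = G, pts = carrier G, med = m,
    act = (\<lambda>g. \<lambda>x\<in>carrier G. g \<otimes>\<^bsub>G\<^esub> x)\<rparr>"

lemma regular_action_simps [simp]:
  "grp (regular_action G m) = G" "pts (regular_action G m) = carrier G"
  "med (regular_action G m) = m"
  "x \<in> carrier G \<Longrightarrow> act (regular_action G m) g x = g \<otimes>\<^bsub>G\<^esub> x"
  by (simp_all add: regular_action_def)

lemma (in group) group_action_translations:
  "group_action G (carrier G) (\<lambda>g. \<lambda>x\<in>carrier G. g \<otimes> x)"
proof -
  have bij: "(\<lambda>x\<in>carrier G. g \<otimes> x) \<in> Bij (carrier G)" if "g \<in> carrier G" for g
  proof -
    have "bij_betw (\<lambda>x. g \<otimes> x) (carrier G) (carrier G)"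
      by (rule bij_betwI[where g = "\<lambda>x. inv g \<otimes> x"]) (use that in \<open>auto simp: inv_solve_left m_assoc[symmetric]\<close>)
    then have "bij_betw (\<lambda>x\<in>carrier G. g \<otimes> x) (carrier G) (carrier G)"
      by (rule iffD1[OF bij_betw_cong, rotated]) simp
    then show ?thesis
      by (simp add: Bij_def)
  qed
  have "(\<lambda>g. \<lambda>x\<in>carrier G. g \<otimes> x) \<in> hom G (BijGroup (carrier G))"
  proof (rule homI)
    fix g h assume gh: "g \<in> carrier G" "h \<in> carrier G"
    show "(\<lambda>x\<in>carrier G. g \<otimes> h \<otimes> x) =
        mult (BijGroup (carrier G)) (\<lambda>x\<in>carrier G. g \<otimes> x) (\<lambda>x\<in>carrier G. h \<otimes> x)"
      using gh bij by (auto simp: BijGroup_def compose_def m_assoc fun_eq_iff)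
  qed (use bij in \<open>simp add: BijGroup_def\<close>)
  then show ?thesis
    by (simp add: group_action_def group_hom_def group_hom_axioms_def group_BijGroup)
qed

lemma ftams_regular_action:
  fixes G (structure)
  assumes "median_group G m"
  shows "ftams (regular_action G m)"
proof -
  interpret median_group G m by fact
  have action: "group_action G (carrier G) (\<lambda>g. \<lambda>x\<in>carrier G. g \<otimes> x)"
    by (rule group_action_translations)
  moreover have "\<exists>g\<in>carrier G. g \<otimes> x = y" if "x \<in> carrier G" "y \<in> carrier G" for x y
    using that by (intro bexI[of _ "y \<otimes> inv x"]) (auto simp: m_assoc)
  ultimately have "transitive_action G (carrier G) (\<lambda>g. \<lambda>x\<in>carrier G. g \<otimes> x)"
    by (simp add: transitive_action_def transitive_action_axioms_def)
  moreover have "fams (regular_action G m)"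
    unfolding fams_def using action median_set_axioms left_invariant
    by (auto simp: regular_action_def median_closed)
  ultimately show ?thesis
    by (simp add: ftams_def regular_action_def)
qed

text \<open>The median axioms are equations, so they may be checked in any family of coordinates that
  separates points.\<close>

lemma median_set_by_coordinates:
  assumes "median_set X m"
    and into: "\<And>f. f \<in> C \<Longrightarrow> f \<in> G \<rightarrow> X"
    and separate: "\<And>a b. \<lbrakk>a \<in> G; b \<in> G; \<And>f. f \<in> C \<Longrightarrow> f a = f b\<rbrakk> \<Longrightarrow> a = b"
    and closed: "\<And>a b c. \<lbrakk>a \<in> G; b \<in> G; c \<in> G\<rbrakk> \<Longrightarrow> n a b c \<in> G"
    and coord: "\<And>f a b c. \<lbrakk>f \<in> C; a \<in> G; b \<in> G; c \<in> G\<rbrakk> \<Longrightarrow> f (n a b c) = m (f a) (f b) (f c)"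
  shows "median_set G n"
proof -
  interpret median_set X m by fact
  have into': "f a \<in> X" if "f \<in> C" "a \<in> G" for f a
    using into that by blast
  show ?thesis
  proof
    fix x y z assume *: "x \<in> G" "y \<in> G" "z \<in> G"
    show "n x y z \<in> G" using * closed by simp
    show "n x y z = n y x z"
      by (rule separate) (use * closed coord into' M1_left in \<open>metis+\<close>)
    show "n x y z = n x z y"
      by (rule separate) (use * closed coord into' M1_right in \<open>metis+\<close>)
    show "n x y x = x"
      by (rule separate) (simp_all add: * closed coord into' M2)
    fix u v assume **: "u \<in> G" "v \<in> G"
    show "n (n x y z) u v = n (n x u v) (n y u v) z"
    proof (rule separate)
      fix f assume f: "f \<in> C"
      show "f (n (n x y z) u v) = f (n (n x u v) (n y u v) z)"
        using M3[of "f x" "f y" "f z" "f u" "f v"] * ** f by (simp add: closed coord into')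
    qed (simp_all add: * ** closed)
  qed
qed

section \<open>Morphisms of free actions and the transfer of universality\<close>

lemma fams_homI:
  assumes "f\<^sub>0 \<in> hom (grp A) (grp B)" "f\<^sub>0 \<in> extensional (carrier (grp A))"
    and "f \<in> pts A \<rightarrow> pts B" "f \<in> extensional (pts A)"
    and "\<And>x y z. \<lbrakk>x \<in> pts A; y \<in> pts A; z \<in> pts A\<rbrakk>
      \<Longrightarrow> f (med A x y z) = med B (f x) (f y) (f z)"
    and "\<And>g x. \<lbrakk>g \<in> carrier (grp A); x \<in> pts A\<rbrakk> \<Longrightarrow> f (act A g x) = act B (f\<^sub>0 g) (f x)"
  shows "(f\<^sub>0, f) \<in> fams_hom A B"
  using assms by (simp add: fams_hom_def median_hom_def)

lemma fams_homD:
  assumes "(f\<^sub>0, f) \<in> fams_hom A B"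
  shows "f\<^sub>0 \<in> hom (grp A) (grp B)" "f\<^sub>0 \<in> extensional (carrier (grp A))"
    and "f \<in> pts A \<rightarrow> pts B" "f \<in> extensional (pts A)"
    and "\<And>x y z. \<lbrakk>x \<in> pts A; y \<in> pts A; z \<in> pts A\<rbrakk>
      \<Longrightarrow> f (med A x y z) = med B (f x) (f y) (f z)"
    and "\<And>g x. \<lbrakk>g \<in> carrier (grp A); x \<in> pts A\<rbrakk> \<Longrightarrow> f (act A g x) = act B (f\<^sub>0 g) (f x)"
  using assms by (auto simp: fams_hom_def median_hom_def)

lemma fams_homD':
  assumes "(f\<^sub>0, f) \<in> fams_hom A B"
  shows "g \<in> carrier (grp A) \<Longrightarrow> f\<^sub>0 g \<in> carrier (grp B)"
    and "\<lbrakk>g \<in> carrier (grp A); h \<in> carrier (grp A)\<rbrakk>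
      \<Longrightarrow> f\<^sub>0 (g \<otimes>\<^bsub>grp A\<^esub> h) = f\<^sub>0 g \<otimes>\<^bsub>grp B\<^esub> f\<^sub>0 h"
    and "x \<in> pts A \<Longrightarrow> f x \<in> pts B"
  using fams_homD(1,3)[OF assms] by (auto simp: hom_def Pi_def)

text \<open>Restricting the composites to the carriers keeps them extensional, as morphisms are required
  to be.\<close>

definition fams_comp ::
  "('g, 'x) median_action \<Rightarrow> ('h \<Rightarrow> 'k) \<times> ('y \<Rightarrow> 'z) \<Rightarrow> ('g \<Rightarrow> 'h) \<times> ('x \<Rightarrow> 'y) \<Rightarrow> ('g \<Rightarrow> 'k) \<times> ('x \<Rightarrow> 'z)"
  where "fams_comp A P i = (compose (carrier (grp A)) (fst P) (fst i), compose (pts A) (snd P) (snd i))"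

definition fams_id :: "('g, 'x) median_action \<Rightarrow> ('g \<Rightarrow> 'g) \<times> ('x \<Rightarrow> 'x)"
  where "fams_id A = (\<lambda>g\<in>carrier (grp A). g, \<lambda>x\<in>pts A. x)"

lemma tup_iff:
  "tup A W i K \<longleftrightarrow>
    (\<forall>p\<in>fams_hom A K. \<exists>!P. P \<in> fams_hom W K \<and> fams_comp A P i = p)"
  unfolding tup_def by (cases i) (simp add: case_prod_unfold prod_eq_iff fams_comp_def)

lemma fams_comp_in:
  assumes "fams A" "f \<in> fams_hom A B" "g \<in> fams_hom B C"
  shows "fams_comp A g f \<in> fams_hom A C"
proof -
  interpret free_median_action "grp A" "pts A" "med A" "act A"
    using assms(1) fams_iff by blast
  obtain f\<^sub>0 f\<^sub>1 where f: "f = (f\<^sub>0, f\<^sub>1)" "(f\<^sub>0, f\<^sub>1) \<in> fams_hom A B"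
    using assms(2) by (cases f) auto
  obtain g\<^sub>0 g\<^sub>1 where g: "g = (g\<^sub>0, g\<^sub>1)" "(g\<^sub>0, g\<^sub>1) \<in> fams_hom B C"
    using assms(3) by (cases g) auto
  note f' = fams_homD[OF f(2)] fams_homD'[OF f(2)] and g' = fams_homD[OF g(2)] fams_homD'[OF g(2)]
  have "(compose (carrier (grp A)) g\<^sub>0 f\<^sub>0, compose (pts A) g\<^sub>1 f\<^sub>1) \<in> fams_hom A C"
  proof (rule fams_homI)
    show "compose (carrier (grp A)) g\<^sub>0 f\<^sub>0 \<in> hom (grp A) (grp C)"
      by (rule homI) (simp_all add: compose_eq f' g')
    show "compose (pts A) g\<^sub>1 f\<^sub>1 \<in> pts A \<rightarrow> pts C"
      by (auto simp: compose_eq f' g')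
  qed (simp_all add: compose_eq f' g' median_closed act_in)
  then show ?thesis
    by (simp add: fams_comp_def f g)
qed

lemma fams_id_in: "fams A \<Longrightarrow> fams_id A \<in> fams_hom A A"
proof -
  assume "fams A"
  then interpret free_median_action "grp A" "pts A" "med A" "act A"
    using fams_iff by blast
  have "(\<lambda>g\<in>carrier (grp A). g) \<in> hom (grp A) (grp A)"
    by (rule homI) auto
  then show ?thesis
    unfolding fams_id_def by (intro fams_homI) (auto simp: median_closed act_in)
qed

lemma fams_hom_components:
  assumes "f \<in> fams_hom A B"
  shows "fst f \<in> carrier (grp A) \<rightarrow> carrier (grp B)" "fst f \<in> extensional (carrier (grp A))"
    "snd f \<in> pts A \<rightarrow> pts B" "snd f \<in> extensional (pts A)"
  using assms fams_homD(1-4)[of "fst f" "snd f" A B] by (simp_all add: hom_def)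

lemma fams_comp_id_left: "f \<in> fams_hom A B \<Longrightarrow> fams_comp A (fams_id B) f = f"
  by (simp add: fams_comp_def fams_id_def fams_hom_components)

lemma fams_comp_id_right: "f \<in> fams_hom A B \<Longrightarrow> fams_comp A f (fams_id A) = f"
  by (simp add: fams_comp_def fams_id_def compose_Id[OF fams_hom_components(1,2)]
      compose_Id[OF fams_hom_components(3,4)])

lemma fams_comp_assoc:
  "f \<in> fams_hom A B \<Longrightarrow> fams_comp A h (fams_comp A g f) = fams_comp A (fams_comp B h g) f"
  by (simp add: fams_comp_def fams_hom_components compose_assoc)

text \<open>The usual argument that universal arrows are isomorphic, with each instance of a universal
  property that it uses listed as a hypothesis. Since \<open>K\<close> may have other types than \<open>V\<close> and \<open>W\<close>,
  the universal property of \<open>V\<close> is carried from one type of targets to another.\<close>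

lemma tup_transfer:
  assumes "fams A" "fams W" "fams V" "i \<in> fams_hom A W" "j \<in> fams_hom A V"
    and "tup A W i V" "tup A V j W" "tup A V j V" "tup A W i K"
  shows "tup A V j K"
  unfolding tup_iff
proof
  fix p assume p: "p \<in> fams_hom A K"
  obtain P where P: "P \<in> fams_hom V W" "fams_comp A P j = i"
    using assms(7,4) unfolding tup_iff by blast
  obtain Q where Q: "Q \<in> fams_hom W V" "fams_comp A Q i = j"
    using assms(6,5) unfolding tup_iff by blast
  have QP: "fams_comp V Q P = fams_id V"
  proof -
    have "fams_comp A (fams_comp V Q P) j = j" "fams_comp A (fams_id V) j = j"
      using P Q fams_comp_assoc[OF assms(5), of Q P] fams_comp_id_left[OF assms(5)] by simp_all
    moreover have "fams_comp V Q P \<in> fams_hom V V" "fams_id V \<in> fams_hom V V"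
      using P Q assms(3) fams_comp_in fams_id_in by blast+
    ultimately show ?thesis
      using assms(8,5) unfolding tup_iff by blast
  qed
  obtain R where R: "R \<in> fams_hom W K" "fams_comp A R i = p"
    using assms(9) p unfolding tup_iff by blast
  show "\<exists>!T. T \<in> fams_hom V K \<and> fams_comp A T j = p"
  proof (rule ex1I[of _ "fams_comp V R P"])
    show "fams_comp V R P \<in> fams_hom V K \<and> fams_comp A (fams_comp V R P) j = p"
      using fams_comp_in[OF assms(3) P(1) R(1)] fams_comp_assoc[OF assms(5), of R P] P R by simp
    fix T assume T: "T \<in> fams_hom V K \<and> fams_comp A T j = p"
    have "fams_comp A (fams_comp W T Q) i = p"
      using T Q fams_comp_assoc[OF assms(4), of T Q] by simp
    moreover have "fams_comp W T Q \<in> fams_hom W K"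
      using T Q assms(2) fams_comp_in by blast
    ultimately have "fams_comp W T Q = R"
      using assms(9) p R unfolding tup_iff by blast
    moreover have "fams_comp V (fams_comp W T Q) P = T"
      using fams_comp_assoc[OF P(1), of T Q] QP T fams_comp_id_right by metis
    ultimately show "T = fams_comp V R P"
      by simp
  qed
qed

section \<open>The universal group of a Brandt groupoid\<close>

type_synonym ('s, 'h) arrow = "'s \<times> 'h \<times> 's"

text \<open>The Brandt groupoid of \<open>H\<close> over \<open>S\<close> has the objects \<open>S\<close> and, between any two of them, one
  arrow for every element of \<open>H\<close>. Its universal group is the free product of \<open>H\<close> with a free group
  on one generator fewer than there are objects; reduced words of arrows serve as its elements
  because they spell out the paths in the tree on which this free product acts.\<close>

locale brandt_groupoid = group H for H :: "'h monoid" (structure) +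
  fixes S :: "'s set"
begin

definition arrows :: "('s, 'h) arrow set"
  where "arrows = S \<times> carrier H \<times> S"

fun source :: "('s, 'h) arrow \<Rightarrow> 's" where "source (s, h, t) = s"
fun target :: "('s, 'h) arrow \<Rightarrow> 's" where "target (s, h, t) = t"
fun is_unit :: "('s, 'h) arrow \<Rightarrow> bool" where "is_unit (s, h, t) \<longleftrightarrow> s = t \<and> h = \<one>"
fun comp :: "('s, 'h) arrow \<Rightarrow> ('s, 'h) arrow \<Rightarrow> ('s, 'h) arrow"
  where "comp (s, h, t) (s', h', t') = (s, h \<otimes> h', t')"
fun reverse :: "('s, 'h) arrow \<Rightarrow> ('s, 'h) arrow"
  where "reverse (s, h, t) = (t, inv h, s)"

definition reduced :: "('s, 'h) arrow list \<Rightarrow> bool"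
  where "reduced w \<longleftrightarrow> set w \<subseteq> arrows \<and> (\<forall>a\<in>set w. \<not> is_unit a) \<and>
    successively (\<lambda>a b. target a \<noteq> source b) w"

text \<open>Left multiplication of a reduced word by an arrow. Defining the product of words by letting
  the letters of the left factor act in turn reduces associativity to the compatibility of this
  action with composition of arrows, \<open>push_push\<close>.\<close>

fun push :: "('s, 'h) arrow \<Rightarrow> ('s, 'h) arrow list \<Rightarrow> ('s, 'h) arrow list" where
  "push a [] = (if is_unit a then [] else [a])"
| "push a (b # w) =
    (if is_unit a then b # w
     else if target a = source b then (if is_unit (comp a b) then w else comp a b # w)
     else a # b # w)"

definition concat_reduce :: "('s, 'h) arrow list \<Rightarrow> ('s, 'h) arrow list \<Rightarrow> ('s, 'h) arrow list"
  where "concat_reduce u v = foldr push u v"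

definition word_group :: "('s, 'h) arrow list monoid"
  where "word_group = \<lparr>carrier = {w. reduced w}, mult = concat_reduce, one = []\<rparr>"

definition word_inv :: "('s, 'h) arrow list \<Rightarrow> ('s, 'h) arrow list"
  where "word_inv w = rev (map reverse w)"

lemma reduced_Nil: "reduced []"
  by (simp add: reduced_def)

lemma reduced_Cons:
  "reduced (a # w) \<longleftrightarrow> a \<in> arrows \<and> \<not> is_unit a \<and> reduced w \<and> (w = [] \<or> target a \<noteq> source (hd w))"
  by (auto simp: reduced_def successively_Cons)

lemma reduced_append:
  "reduced (u @ v) \<longleftrightarrow>
    reduced u \<and> reduced v \<and> (u = [] \<or> v = [] \<or> target (last u) \<noteq> source (hd v))"
  by (auto simp: reduced_def successively_append_iff)

lemma source_comp: "source (comp a b) = source a"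
  by (cases a; cases b) simp

lemma target_comp: "target (comp a b) = target b"
  by (cases a; cases b) simp

lemma source_reverse: "source (reverse a) = target a"
  by (cases a) simp

lemma target_reverse: "target (reverse a) = source a"
  by (cases a) simp

lemma comp_arrows: "\<lbrakk>a \<in> arrows; b \<in> arrows\<rbrakk> \<Longrightarrow> comp a b \<in> arrows"
  by (cases a; cases b) (auto simp: arrows_def)

lemma reverse_arrows: "a \<in> arrows \<Longrightarrow> reverse a \<in> arrows"
  by (cases a) (auto simp: arrows_def)

lemma is_unit_reverse: "a \<in> arrows \<Longrightarrow> is_unit (reverse a) \<longleftrightarrow> is_unit a"
  by (cases a) (auto simp: arrows_def)

lemma reverse_comp: "a \<in> arrows \<Longrightarrow> is_unit (comp (reverse a) a)"
  by (cases a) (auto simp: arrows_def)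

lemma push_unit: "is_unit a \<Longrightarrow> push a w = w"
  by (cases w) auto

lemma push_reduced: "reduced (a # w) \<Longrightarrow> push a w = a # w"
  by (cases w) (auto simp: reduced_Cons)

lemma reduced_push: "\<lbrakk>a \<in> arrows; reduced w\<rbrakk> \<Longrightarrow> reduced (push a w)"
  by (cases w) (auto simp: reduced_Cons reduced_Nil comp_arrows target_comp)

text \<open>Pushing two composable arrows agrees with pushing their composite. The delicate case is that
  \<open>b\<close> cancels the first letter of \<open>w\<close>: then the next letter of \<open>w\<close> does not compose with \<open>a\<close>, since
  \<open>w\<close> is reduced.\<close>

lemma push_push:
  assumes "a \<in> arrows" "b \<in> arrows" "target a = source b" "reduced w"
  shows "push a (push b w) = push (comp a b) w"
proof -
  obtain s h t k u where ab: "a = (s, h, t)" "b = (t, k, u)"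
    using assms(3) by (cases a; cases b) auto
  have mem: "h \<in> carrier H" "k \<in> carrier H" "s \<in> S" "t \<in> S" "u \<in> S"
    using assms ab by (auto simp: arrows_def)
  show ?thesis
  proof (cases w)
    case Nil
    then show ?thesis
      using mem ab by (cases "is_unit b") auto
  next
    case (Cons c w')
    obtain p l q where c: "c = (p, l, q)" by (cases c)
    have l: "l \<in> carrier H" "p \<noteq> q \<or> l \<noteq> \<one>" and w': "reduced w'" "w' = [] \<or> q \<noteq> source (hd w')"
      using assms Cons c by (auto simp: reduced_Cons arrows_def)
    have assoc: "h \<otimes> k \<otimes> l = h \<otimes> (k \<otimes> l)"
      using mem l by (simp add: m_assoc)
    have cancel: "h \<otimes> (k \<otimes> l) = l" if "h \<otimes> k = \<one>"
      using that assoc l by simp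
    consider "is_unit a" | "is_unit b" | "\<not> is_unit a" "\<not> is_unit b" "u \<noteq> p"
      | "\<not> is_unit a" "\<not> is_unit b" "u = p" "is_unit (comp b c)"
      | "\<not> is_unit a" "\<not> is_unit b" "u = p" "\<not> is_unit (comp b c)" by blast
    then show ?thesis
    proof cases
      case 4
      then have "push a w' = a # w'"
        using 4 assms c w' ab by (intro push_reduced) (auto simp: reduced_Cons)
      moreover have "comp (comp a b) c = a"
        using 4 ab c mem assoc by simp
      ultimately show ?thesis
        using 4 ab Cons c l mem by (auto simp: assoc dest: cancel)
    next
      case 5
      show ?thesis
        using 5 ab Cons c l mem by (auto simp: assoc dest: cancel)
    qed (use ab mem Cons c l assoc in \<open>auto simp: push_unit\<close>)
  qed
qed

lemma reduced_concat_reduce: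
  "\<lbrakk>reduced u; reduced v\<rbrakk> \<Longrightarrow> reduced (concat_reduce u v)"
  by (induction u) (auto simp: concat_reduce_def reduced_Cons reduced_push)

lemma concat_reduce_reduced: "reduced (u @ v) \<Longrightarrow> concat_reduce u v = u @ v"
proof (induction u)
  case (Cons a u)
  then have "concat_reduce u v = u @ v"
    by (simp add: reduced_Cons)
  then show ?case
    using Cons.prems push_reduced[of a "u @ v"] by (simp add: concat_reduce_def)
qed (simp add: concat_reduce_def)

lemma concat_reduce_push:
  assumes "a \<in> arrows" "reduced u" "reduced v"
  shows "concat_reduce (push a u) v = push a (concat_reduce u v)"
proof (cases u)
  case Nil
  then show ?thesis by (auto simp: concat_reduce_def push_unit)
next
  case (Cons b w)
  have b: "b \<in> arrows" "reduced w"
    using assms Cons by (auto simp: reduced_Cons)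
  have red: "reduced (concat_reduce w v)"
    using b assms reduced_concat_reduce by blast
  have eq: "push a (push b (concat_reduce w v)) = push (comp a b) (concat_reduce w v)" if "target a = source b"
    by (rule push_push) (use that assms b red in auto)
  have "concat_reduce (push a u) v = push a (push b (concat_reduce w v))"
  proof (cases "target a = source b")
    case True
    then show ?thesis
      using eq[OF True] Cons by (auto simp: concat_reduce_def push_unit)
  qed (auto simp: Cons concat_reduce_def push_unit)
  then show ?thesis
    by (simp add: Cons concat_reduce_def)
qed

lemma concat_reduce_assoc:
  "\<lbrakk>reduced u; reduced v; reduced w\<rbrakk>
    \<Longrightarrow> concat_reduce (concat_reduce u v) w = concat_reduce u (concat_reduce v w)"
proof (induction u)
  case Nil
  then show ?case by (simp add: concat_reduce_def)
next
  case (Cons a u)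
  then have "concat_reduce (push a (concat_reduce u v)) w = push a (concat_reduce u (concat_reduce v w))"
    by (subst concat_reduce_push) (auto simp: reduced_Cons reduced_concat_reduce)
  then show ?case
    by (simp add: concat_reduce_def)
qed

lemma reduced_word_inv: "reduced w \<Longrightarrow> reduced (word_inv w)"
proof (induction w)
  case (Cons a w)
  then have *: "reduced (word_inv w)" "a \<in> arrows" "\<not> is_unit a" "w = [] \<or> target a \<noteq> source (hd w)"
    by (auto simp: reduced_Cons)
  have "last (rev (map reverse w)) = reverse (hd w)" if "w \<noteq> []"
    using that by (simp add: last_rev hd_map)
  then show ?case
    using * by (auto simp: word_inv_def reduced_append reduced_Cons reduced_Nil source_reverse
        target_reverse reverse_arrows is_unit_reverse)
qed (simp add: word_inv_def reduced_Nil)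

lemma word_inv_cancel: "reduced w \<Longrightarrow> concat_reduce (word_inv w) w = []"
proof (induction w)
  case (Cons a w)
  then have *: "reduced w" "a \<in> arrows"
    by (auto simp: reduced_Cons)
  have "push (reverse a) (a # w) = push (reverse a) (push a w)"
    using Cons.prems by (simp add: push_reduced)
  also have "\<dots> = w"
    using * by (subst push_push) (auto simp: reverse_arrows target_reverse reverse_comp push_unit)
  finally show ?case
    using Cons.IH * by (simp add: concat_reduce_def word_inv_def)
qed (simp add: concat_reduce_def word_inv_def)

sublocale words: group word_group
proof (rule groupI, simp_all add: word_group_def)
  fix u v w assume "reduced u"
  then show "\<exists>v. reduced v \<and> concat_reduce v u = []"
    using reduced_word_inv word_inv_cancel by blast
qed (auto simp: reduced_concat_reduce reduced_Nil concat_reduce_assoc, simp add: concat_reduce_def)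

lemma inv_word_group: "reduced w \<Longrightarrow> inv\<^bsub>word_group\<^esub> w = word_inv w"
  using words.inv_equality[of "word_inv w" w] reduced_word_inv word_inv_cancel
  by (simp add: word_group_def)

end

section \<open>The tree of copies of a free median action\<close>

context free_median_action
begin

text \<open>Every point is written uniquely as \<open>coeff x\<close> applied to the chosen representative \<open>rep x\<close> of its
  orbit. The representative is chosen from the orbit as a set, so that all points of an orbit get
  the same one.\<close>

definition rep :: "'x \<Rightarrow> 'x"
  where "rep x = (SOME y. y \<in> orbit H \<phi> x)"

definition coeff :: "'x \<Rightarrow> 'h"
  where "coeff x = (THE g. g \<in> carrier H \<and> \<phi> g (rep x) = x)"

lemma rep_orbit:
  assumes "x \<in> X"
  obtains g where "g \<in> carrier H" "\<phi> g x = rep x"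
proof -
  have "rep x \<in> orbit H \<phi> x"
    unfolding rep_def by (rule someI) (use assms orbit_refl in blast)
  then show thesis
    using that by (auto simp: orbit_def)
qed

lemma rep_in: "x \<in> X \<Longrightarrow> rep x \<in> X"
  using act_in by (metis rep_orbit)

lemma coeff_props:
  assumes "x \<in> X"
  shows "coeff x \<in> carrier H" "\<phi> (coeff x) (rep x) = x"
proof -
  obtain g where g: "g \<in> carrier H" "\<phi> g x = rep x"
    using assms rep_orbit by blast
  then have "inv g \<in> carrier H \<and> \<phi> (inv g) (rep x) = x"
    using assms act_inv_act by (metis inv_closed)
  then have "\<exists>!h. h \<in> carrier H \<and> \<phi> h (rep x) = x"
    using act_cancel rep_in assms by metis
  from theI'[OF this] show "coeff x \<in> carrier H" "\<phi> (coeff x) (rep x) = x"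
    by (simp_all add: coeff_def)
qed

lemma coeff_eq: "\<lbrakk>x \<in> X; g \<in> carrier H; \<phi> g (rep x) = x\<rbrakk> \<Longrightarrow> coeff x = g"
  using act_cancel coeff_props rep_in by metis

lemma rep_act:
  assumes "g \<in> carrier H" "x \<in> X"
  shows "rep (\<phi> g x) = rep x"
proof -
  have "\<phi> h (\<phi> g x) \<in> orbit H \<phi> x" "\<phi> h x \<in> orbit H \<phi> (\<phi> g x)" if "h \<in> carrier H" for h
  proof -
    have "\<phi> h (\<phi> g x) = \<phi> (h \<otimes> g) x"
      using that assms by (simp add: act_mult)
    then show "\<phi> h (\<phi> g x) \<in> orbit H \<phi> x"
      using that assms unfolding orbit_def by blast
    have "\<phi> h x = \<phi> (h \<otimes> inv g) (\<phi> g x)"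
      using that assms by (simp add: act_mult act_inv_act act_in)
    then show "\<phi> h x \<in> orbit H \<phi> (\<phi> g x)"
      using that assms unfolding orbit_def by blast
  qed
  then have "orbit H \<phi> (\<phi> g x) = orbit H \<phi> x"
    unfolding orbit_def by blast
  then show ?thesis
    by (simp add: rep_def)
qed

lemma coeff_act: "\<lbrakk>g \<in> carrier H; x \<in> X\<rbrakk> \<Longrightarrow> coeff (\<phi> g x) = g \<otimes> coeff x"
  by (intro coeff_eq) (auto simp: act_in rep_act act_mult coeff_props rep_in)

lemma rep_rep: "x \<in> X \<Longrightarrow> rep (rep x) = rep x"
  using rep_act coeff_props rep_in by metis

lemma coeff_rep: "x \<in> X \<Longrightarrow> coeff (rep x) = \<one>"
  by (intro coeff_eq) (auto simp: rep_in rep_rep act_one)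

sublocale brandt_groupoid H "rep ` X"
  by unfold_locales

abbreviation wmult (infixl "\<cdot>" 70)
  where "u \<cdot> v \<equiv> concat_reduce u v"

text \<open>An arrow \<open>a\<close> with source \<open>rep x\<close> is the class of exactly one pair \<open>[x, y]\<close> starting at \<open>x\<close>, and
  \<open>step x a\<close> is this \<open>y\<close>.\<close>

fun step :: "'x \<Rightarrow> ('x, 'h) arrow \<Rightarrow> 'x"
  where "step x (s, h, t) = \<phi> (coeff x \<otimes> h) t"

text \<open>The copy of \<open>X\<close> on which \<open>x\<close> sits at the empty word consists of the words \<open>[x, y]\<close>. A reduced
  word whose first letter is \<open>[x, y]\<close> leaves this copy at \<open>y\<close>; any other word leaves it at once, at
  \<open>x\<close>. The remaining coordinates on the group are obtained by left translation.\<close>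

fun proj :: "'x \<Rightarrow> ('x, 'h) arrow list \<Rightarrow> 'x" where
  "proj x [] = x"
| "proj x (a # w) = (if source a = rep x then step x a else x)"

definition arrow_between :: "'x \<Rightarrow> 'x \<Rightarrow> ('x, 'h) arrow"
  where "arrow_between x y = (rep x, inv (coeff x) \<otimes> coeff y, rep y)"

lemma arrow_between:
  assumes "x \<in> X" "y \<in> X"
  shows "arrow_between x y \<in> arrows" "source (arrow_between x y) = rep x"
    "target (arrow_between x y) = rep y" "step x (arrow_between x y) = y"
  using assms by (auto simp: arrow_between_def arrows_def coeff_props m_assoc[symmetric])

lemma step:
  assumes "x \<in> X" "a \<in> arrows"
  shows "step x a \<in> X" "rep (step x a) = target a"
proof -
  obtain s h t where a: "a = (s, h, t)" by (cases a)
  then show "step x a \<in> X" "rep (step x a) = target a"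
    using assms by (auto simp: arrows_def act_in coeff_props rep_in rep_act rep_rep)
qed

lemma step_unit: "\<lbrakk>x \<in> X; is_unit a; source a = rep x\<rbrakk> \<Longrightarrow> step x a = x"
  by (cases a) (auto simp: coeff_props)

lemma step_step: "\<lbrakk>x \<in> X; a \<in> arrows; b \<in> arrows\<rbrakk> \<Longrightarrow> step (step x a) b = step x (comp a b)"
  by (cases a; cases b) (auto simp: arrows_def coeff_act coeff_props coeff_rep rep_in m_assoc)

lemma proj_in: "\<lbrakk>x \<in> X; reduced w\<rbrakk> \<Longrightarrow> proj x w \<in> X"
  by (cases w) (auto simp: reduced_Cons step)

lemma proj_push:
  assumes "x \<in> X" "a \<in> arrows" "source a = rep x" "reduced w"
  shows "proj x (push a w) = proj (step x a) w"
proof (cases w)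
  case Nil
  then show ?thesis
    using assms by (auto simp: step_unit)
next
  case (Cons b w')
  have w': "w' = [] \<or> target b \<noteq> source (hd w')" "b \<in> arrows"
    using assms Cons by (auto simp: reduced_Cons)
  show ?thesis
  proof (cases "is_unit a")
    case True
    then show ?thesis
      using assms by (simp add: push_unit step_unit)
  next
    case False
    have "step x (comp a b) = x" if "target a = source b" "is_unit (comp a b)"
      using that assms step_unit[of x "comp a b"] by (simp add: source_comp)
    moreover have "proj x w' = x" if "target a = source b" "is_unit (comp a b)"
    proof -
      have "target b = rep x"
        using that assms(3) by (cases a; cases b) auto
      then show ?thesis
        using w' by (cases w') auto
    qed
    ultimately show ?thesis
      using assms w' Cons False by (auto simp: step step_step source_comp)
  qed
qed

lemma proj_Cons_source:
  "\<lbrakk>x \<in> X; reduced (a # w); source a = rep x\<rbrakk> \<Longrightarrow> proj x (a # w) = proj (step x a) w"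
  using proj_push[of x a w] by (simp add: push_reduced reduced_Cons)

lemma source_hd_push:
  assumes "reduced k" "k \<noteq> []" "a \<in> arrows"
  shows "k \<cdot> push a [] = [] \<or> source (hd (k \<cdot> push a [])) = source (hd k)"
  using assms
proof (induction k)
  case (Cons b k)
  show ?case
  proof (cases "k = []")
    case True
    then show ?thesis
      using Cons.prems by (auto simp: concat_reduce_def reduced_Cons source_comp)
  next
    case False
    let ?v = "k \<cdot> push a []"
    have "?v = [] \<or> source (hd ?v) = source (hd k)"
      using Cons False by (auto simp: reduced_Cons)
    moreover have "target b \<noteq> source (hd k)"
      using Cons False by (auto simp: reduced_Cons)
    moreover have "(b # k) \<cdot> push a [] = push b ?v"
      by (simp add: concat_reduce_def)
    ultimately show ?thesis
      using Cons.prems by (cases ?v) (auto simp: reduced_Cons)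
  qed
qed simp

text \<open>One letter \<open>a\<close> written to the right of \<open>k\<close> changes a coordinate only if both \<open>k\<close> and the new
  word lie on the copy that the coordinate projects to. In that case the coordinate, seen from
  \<open>k\<close>, is the projection to the copy through the empty word that \<open>a\<close> runs along. Everything
  about medians below is deduced from this dichotomy.\<close>

lemma proj_step_or_copy:
  assumes "reduced k" "a \<in> arrows" "x \<in> X"
  shows "proj x (k \<cdot> push a []) = proj x k \<or>
    (\<exists>y\<in>X. rep y = source a \<and> (\<forall>w. reduced w \<longrightarrow> proj x (k \<cdot> w) = proj y w))"
  using assms(1,3)
proof (induction k arbitrary: x)
  case Nil
  then show ?case
    using assms(2) by (cases "rep x = source a") (auto simp: concat_reduce_def)
next
  case (Cons b k)
  have b: "b \<in> arrows" "reduced k" "\<not> is_unit b"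
    using Cons.prems by (auto simp: reduced_Cons)
  have push: "(b # k) \<cdot> w = push b (k \<cdot> w)" for w
    by (simp add: concat_reduce_def)
  have pa: "reduced (push a [])"
    by (rule reduced_push) (simp_all add: assms(2) reduced_Nil)
  show ?case
  proof (cases "source b = rep x")
    case True
    have "proj x ((b # k) \<cdot> w) = proj (step x b) (k \<cdot> w)" if "reduced w" for w
      unfolding push using True b Cons.prems that
      by (intro proj_push) (auto simp: reduced_concat_reduce)
    moreover have "proj x (b # k) = proj (step x b) k"
      using True Cons.prems by (intro proj_Cons_source)
    ultimately show ?thesis
      using Cons.IH[of "step x b"] b Cons.prems step pa by auto
  next
    case False
    have "proj x (push b (k \<cdot> push a [])) = x"
    proof (cases "k = []")
      case True
      then show ?thesis
        using False b by (auto simp: concat_reduce_def source_comp)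
    next
      case k: False
      then have "k \<cdot> push a [] = [] \<or> source (hd (k \<cdot> push a [])) \<noteq> target b"
        using source_hd_push[of k a] b assms(2) Cons.prems by (auto simp: reduced_Cons)
      then show ?thesis
        using False b by (cases "k \<cdot> push a []") auto
    qed
    then show ?thesis
      using False by (simp add: push)
  qed
qed

lemma reduced_word_inv_append:
  assumes "reduced u" "reduced v" "u = [] \<or> v = [] \<or> source (hd u) \<noteq> source (hd v)"
  shows "reduced (word_inv u @ v)"
proof -
  have "target (last (word_inv u)) = source (hd u)" if "u \<noteq> []"
    using that by (simp add: word_inv_def last_rev hd_map target_reverse)
  then show ?thesis
    using assms reduced_word_inv by (auto simp: reduced_append word_inv_def)
qed

lemma concat_reduce_Cons:
  assumes "reduced k" "reduced (a # w)"
  shows "k \<cdot> (a # w) = (k \<cdot> [a]) \<cdot> w"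
proof -
  have a: "reduced [a]" "reduced w"
    using assms(2) by (simp_all add: reduced_Cons reduced_Nil)
  have "a # w = [a] \<cdot> w"
    using concat_reduce_reduced[of "[a]" w] assms by simp
  then show ?thesis
    using concat_reduce_assoc[OF assms(1) a] by simp
qed

text \<open>If the first letter \<open>[y, z]\<close> of a reduced path changes the coordinate, then by
  \<open>proj_step_or_copy\<close> the coordinate is the projection from \<open>y\<close>, which reads only the first letter
  and is therefore constant from then on.\<close>

lemma proj_changes_once:
  assumes "reduced (u @ v)" "reduced k" "x \<in> X"
  shows "proj x (k \<cdot> u) = proj x k \<or> proj x (k \<cdot> (u @ v)) = proj x (k \<cdot> u)"
  using assms(1,2)
proof (induction u arbitrary: k)
  case Nil
  then show ?case
    using words.r_one[of k] by (simp add: word_group_def)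
next
  case (Cons a u)
  have a: "a \<in> arrows" "\<not> is_unit a" "reduced (u @ v)" "reduced (a # u)" "reduced [a]"
    using Cons.prems by (auto simp: reduced_Cons reduced_append reduced_Nil)
  have split: "k \<cdot> (a # u) = k \<cdot> [a] \<cdot> u" "k \<cdot> (a # u @ v) = k \<cdot> [a] \<cdot> (u @ v)"
    using concat_reduce_Cons[of k a u] concat_reduce_Cons[of k a "u @ v"] Cons.prems a by simp_all
  consider "proj x (k \<cdot> [a]) = proj x k"
    | y where "y \<in> X" "rep y = source a" "\<And>w. reduced w \<Longrightarrow> proj x (k \<cdot> w) = proj y w"
    using proj_step_or_copy[OF Cons.prems(2) a(1) assms(3)] a(2) by auto
  then show ?case
  proof cases
    case 1
    then show ?thesis
      using Cons.IH[of "k \<cdot> [a]"] a Cons.prems reduced_concat_reduce split by auto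
  next
    case 2
    then show ?thesis
      using a Cons.prems by simp
  qed
qed

lemma word_simps [simp]:
  "carrier word_group = {w. reduced w}" "mult word_group = concat_reduce" "one word_group = []"
  by (simp_all add: word_group_def)

text \<open>After a translation one of the two words is empty. A nonempty reduced word with the first
  letter \<open>[s, y]\<close> differs from the empty one in the projection from \<open>s\<close>, because \<open>y \<noteq> s\<close>.\<close>

lemma coordinates_separate:
  assumes "reduced g" "reduced g'"
    and "\<And>k x. \<lbrakk>reduced k; x \<in> X\<rbrakk> \<Longrightarrow> proj x (k \<cdot> g) = proj x (k \<cdot> g')"
  shows "g = g'"
proof -
  let ?k = "inv\<^bsub>word_group\<^esub> g'"
  have k: "reduced ?k"
    using words.inv_closed assms(2) by simp
  have fixes_all: "proj x (?k \<cdot> g) = x" if "x \<in> X" for x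
    using assms(3)[OF k that] words.l_inv[of g'] assms(2) by simp
  have "?k \<cdot> g = []"
  proof (cases "?k \<cdot> g")
    case (Cons a w)
    obtain s h t where a: "a = (s, h, t)" by (cases a)
    have mem: "s \<in> rep ` X" "h \<in> carrier H" "t \<in> rep ` X" "\<not> is_unit a"
      using reduced_concat_reduce[OF k assms(1)] Cons a by (auto simp: reduced_Cons arrows_def)
    then have st: "s \<in> X" "t \<in> X" "rep s = s" "coeff s = \<one>" "rep t = t"
      by (auto simp: rep_in rep_rep coeff_rep)
    then have eq: "\<phi> h t = s"
      using fixes_all[of s] Cons a mem by simp
    then have "t = s"
      using rep_act[of h t] st mem by simp
    then show ?thesis
      using eq free[of h t] mem st a by simp
  qed
  then have eq: "inv\<^bsub>word_group\<^esub> g = ?k"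
    using words.inv_equality[of ?k g] assms(1) k by simp
  have "g = inv\<^bsub>word_group\<^esub> (inv\<^bsub>word_group\<^esub> g)"
    using words.inv_inv[of g] assms(1) by simp
  also have "\<dots> = g'"
    unfolding eq using words.inv_inv[of g'] assms(2) by simp
  finally show ?thesis .
qed

text \<open>The median of the empty word, \<open>g\<close> and \<open>g'\<close> is found by following the common initial part of
  \<open>g\<close> and \<open>g'\<close>. If the two paths then part along different copies, the branch point is the median.
  If they part along one copy, at points \<open>y\<close> and \<open>y'\<close> reached from \<open>x\<close>, the median is the point
  \<open>m x y y'\<close> of that copy. The condition on the first letter of \<open>c\<close> keeps the word reduced when
  the common letter is put back in front.\<close>

lemma median_with_origin:
  assumes "reduced g" "reduced g'"
  shows "\<exists>c. reduced c \<and> (c = [] \<or> g \<noteq> [] \<and> source (hd c) = source (hd g)) \<and>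
    (\<forall>k x. reduced k \<longrightarrow> x \<in> X \<longrightarrow> m (proj x k) (proj x (k \<cdot> g)) (proj x (k \<cdot> g')) = proj x (k \<cdot> c))"
  using assms
proof (induction g arbitrary: g')
  case Nil
  have "k \<cdot> [] = k" if "reduced k" for k
    using words.r_one[of k] that by simp
  then show ?case
    using Nil by (intro exI[of _ "[]"]) (auto simp: reduced_Nil majority proj_in reduced_concat_reduce)
next
  case (Cons a r)
  have nil: "k \<cdot> [] = k" if "reduced k" for k
    using words.r_one[of k] that by simp
  have a: "a \<in> arrows" "\<not> is_unit a" "reduced r" "reduced [a]" "r = [] \<or> target a \<noteq> source (hd r)"
    using Cons.prems by (auto simp: reduced_Cons reduced_Nil)
  show ?case
  proof (cases g')
    case Nil
    then show ?thesis
      using Cons.prems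
      by (intro exI[of _ "[]"]) (auto simp: reduced_Nil majority proj_in reduced_concat_reduce nil)
  next
    case g': (Cons a' r')
    have a': "a' \<in> arrows" "\<not> is_unit a'" "reduced r'" "reduced [a']"
        "r' = [] \<or> target a' \<noteq> source (hd r')"
      using Cons.prems g' by (auto simp: reduced_Cons reduced_Nil)
    consider "a = a'" | "source a \<noteq> source a'" | "a \<noteq> a'" "source a = source a'" by blast
    then show ?thesis
    proof cases
      case 1
      obtain c where c: "reduced c" "c = [] \<or> r \<noteq> [] \<and> source (hd c) = source (hd r)"
        and med: "\<And>k x. \<lbrakk>reduced k; x \<in> X\<rbrakk>
          \<Longrightarrow> m (proj x k) (proj x (k \<cdot> r)) (proj x (k \<cdot> r')) = proj x (k \<cdot> c)"
        using Cons.IH[OF a(3) a'(3)] by blast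
      \<comment> \<open>If the common letter moves a coordinate, that coordinate is settled by it; otherwise the
        induction hypothesis applies from the far end of the letter.\<close>
      have ac: "reduced (a # c)"
        using a c by (auto simp: reduced_Cons)
      have "m (proj x k) (proj x (k \<cdot> (a # r))) (proj x (k \<cdot> (a # r'))) = proj x (k \<cdot> (a # c))"
        if k: "reduced k" "x \<in> X" for k x
      proof -
        have ka: "reduced (k \<cdot> [a])"
          using k a reduced_concat_reduce by blast
        have split: "k \<cdot> (a # r) = k \<cdot> [a] \<cdot> r" "k \<cdot> (a # r') = k \<cdot> [a] \<cdot> r'"
            "k \<cdot> (a # c) = k \<cdot> [a] \<cdot> c"
          by (rule concat_reduce_Cons[OF k(1)]; use Cons.prems g' 1 ac in simp)+
        consider "proj x (k \<cdot> [a]) = proj x k"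
          | y where "y \<in> X" "rep y = source a" "\<And>w. reduced w \<Longrightarrow> proj x (k \<cdot> w) = proj y w"
          using proj_step_or_copy[OF k(1) a(1) k(2)] a(2) by auto
        then show ?thesis
        proof cases
          case 1
          then show ?thesis
            using med[OF ka k(2)] split by simp
        next
          case (2 y)
          have "proj x k = y"
            using 2(3)[of "[]"] reduced_Nil nil k by simp
          then show ?thesis
            using 2(1,2) 2(3)[OF Cons.prems(1)] 2(3)[OF ac] 2(3)[of "a # r'"] Cons.prems g' 1 a
            by (simp add: majority step)
        qed
      qed
      then show ?thesis
        using ac 1 g' by (intro exI[of _ "a # c"]) auto
    next
      case 2
      \<comment> \<open>The path from \<open>g\<close> back to the origin and on to \<open>g'\<close> is reduced, so no coordinate moves on
        both of its halves.\<close>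
      have red: "reduced (word_inv (a # r) @ g')"
        by (rule reduced_word_inv_append) (use Cons.prems 2 g' in auto)
      have "m (proj x k) (proj x (k \<cdot> (a # r))) (proj x (k \<cdot> g')) = proj x k"
        if k: "reduced k" "x \<in> X" for k x
      proof -
        let ?p = "k \<cdot> (a # r)"
        have p: "reduced ?p"
          using k Cons.prems reduced_concat_reduce by blast
        have winv: "word_inv (a # r) = inv\<^bsub>word_group\<^esub> (a # r)"
          using inv_word_group Cons.prems by simp
        have return: "?p \<cdot> word_inv (a # r) = k"
          using words.m_assoc[of k "a # r" "word_inv (a # r)"] words.r_inv[of "a # r"]
            Cons.prems k reduced_word_inv nil unfolding winv[symmetric] by simp
        have "?p \<cdot> (word_inv (a # r) @ g') = k \<cdot> g'"
          using words.m_assoc[of ?p "word_inv (a # r)" g'] concat_reduce_reduced[OF red] p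
            Cons.prems reduced_word_inv return by simp
        then have "proj x k = proj x ?p \<or> proj x (k \<cdot> g') = proj x k"
          using proj_changes_once[OF red p k(2)] return by simp
        then show ?thesis
          using k p Cons.prems by (auto simp: majority proj_in reduced_concat_reduce)
      qed
      then show ?thesis
        by (intro exI[of _ "[]"]) (auto simp: reduced_Nil nil)
    next
      case 3
      obtain s h t where A: "a = (s, h, t)" by (cases a)
      obtain h' t' where A': "a' = (s, h', t')" using 3 A by (cases a') auto
      have mem: "s \<in> rep ` X" "h \<in> carrier H" "t \<in> rep ` X" "h' \<in> carrier H" "t' \<in> rep ` X"
        using a a' A A' by (auto simp: arrows_def)
      then have s: "s \<in> X" "t \<in> X" "t' \<in> X" "rep s = s" "coeff s = \<one>"
        by (auto simp: rep_in rep_rep coeff_rep)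
      \<comment> \<open>Reading the common copy from its point \<open>s\<close>, the two paths leave it at \<open>\<phi> h t\<close> and
        \<open>\<phi> h' t'\<close>.\<close>
      define z where "z = m s (\<phi> h t) (\<phi> h' t')"
      have z: "z \<in> X"
        using s mem by (simp add: z_def median_closed act_in)
      define e where "e = arrow_between s z"
      have e: "e \<in> arrows" "source e = s"
        using arrow_between[OF s(1) z] s by (simp_all add: e_def)
      define c where "c = push e []"
      have c: "reduced c"
        unfolding c_def by (rule reduced_push) (simp_all add: e reduced_Nil)
      \<comment> \<open>The arrow across the common copy, from the exit of \<open>g\<close> to the exit of \<open>g'\<close>.\<close>
      define d where "d = comp (reverse a) a'"
      have d: "d \<in> arrows" "source d = target a" "target d = target a'"
        using a a' by (simp_all add: d_def comp_arrows reverse_arrows source_comp target_comp source_reverse)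
      have d_nonunit: "\<not> is_unit d"
      proof
        assume "is_unit d"
        then have "t = t'" "inv h \<otimes> h' = \<one>"
          using A A' by (auto simp: d_def)
        then have "h = h'"
          using mem by (metis inv_closed inv_equality inv_inv)
        then show False
          using 3 A A' \<open>t = t'\<close> by simp
      qed
      have ad: "[a] \<cdot> [d] = [a']"
      proof -
        have "[a] \<cdot> [d] = push a (push d [])"
          using d_nonunit by (simp add: concat_reduce_def)
        also have "\<dots> = push (comp a d) []"
          by (rule push_push) (use a d reduced_Nil in auto)
        also have "comp a d = a'"
          using mem A A' by (simp add: d_def m_assoc[symmetric])
        finally show ?thesis
          using a' by simp
      qed
      have red: "reduced ((word_inv r @ [d]) @ r')" "reduced (word_inv r @ ([d] @ r'))"
          "reduced (word_inv r @ [d])"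
        using reduced_word_inv_append[of r "d # r'"] reduced_word_inv_append[of r "[d]"]
          a a' d d_nonunit by (auto simp: reduced_Cons reduced_Nil)
      have "m (proj x k) (proj x (k \<cdot> (a # r))) (proj x (k \<cdot> (a' # r'))) = proj x (k \<cdot> c)"
        if k: "reduced k" "x \<in> X" for k x
      proof -
        \<comment> \<open>Either the coordinate is the projection to the common copy, or it is constant on that copy.
          In the second case it cannot move on both tails, which are joined across the copy to a
          reduced path.\<close>
        consider (inside) y where "y \<in> X" "rep y = s" "\<And>w. reduced w \<Longrightarrow> proj x (k \<cdot> w) = proj y w"
          | (outside) "proj x (k \<cdot> [a]) = proj x k" "proj x (k \<cdot> [a']) = proj x k"
            "proj x (k \<cdot> c) = proj x k"
          using proj_step_or_copy[OF k(1) a(1) k(2)] proj_step_or_copy[OF k(1) a'(1) k(2)]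
            proj_step_or_copy[OF k(1) e(1) k(2)] a(2) a'(2) A A' e(2) unfolding c_def by auto
        then show ?thesis
        proof cases
          case inside
          have "proj y c = step y e"
            unfolding c_def using proj_push[of y e "[]"] inside e reduced_Nil by simp
          also have "\<dots> = \<phi> (coeff y) z"
            using e_def arrow_between_def s inside z coeff_props act_mult
            by (simp add: rep_in m_assoc)
          also have "\<dots> = m y (\<phi> (coeff y \<otimes> h) t) (\<phi> (coeff y \<otimes> h') t')"
            using inside s mem coeff_props[of y] by (simp add: z_def act_med act_in act_mult)
          finally show ?thesis
            using inside(3)[of "[]"] inside(3)[OF c] inside(3)[of "a # r"] inside(3)[of "a' # r'"]
              inside(2) Cons.prems g' k reduced_Nil nil A A' by simp
        next
          case outside
          let ?p = "k \<cdot> (a # r)"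
          have p: "reduced ?p"
            using k Cons.prems reduced_concat_reduce by blast
          have split: "?p = k \<cdot> [a] \<cdot> r" "k \<cdot> (a' # r') = k \<cdot> [a'] \<cdot> r'"
            by (rule concat_reduce_Cons[OF k(1)]; use Cons.prems g' in simp)+
          have rr: "reduced [d]" "reduced (word_inv r)" "reduced (k \<cdot> [a])"
            using d d_nonunit reduced_word_inv a k reduced_concat_reduce
            by (auto simp: reduced_Cons reduced_Nil)
          have winv: "word_inv r = inv\<^bsub>word_group\<^esub> r"
            using inv_word_group a by simp
          have return: "?p \<cdot> word_inv r = k \<cdot> [a]"
            using words.m_assoc[of "k \<cdot> [a]" r "word_inv r"] words.r_inv[of r] rr a nil
            unfolding winv[symmetric] split by simp
          have across: "?p \<cdot> (word_inv r @ [d]) = k \<cdot> [a']"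
            using words.m_assoc[of ?p "word_inv r" "[d]"] words.m_assoc[of k "[a]" "[d]"]
              concat_reduce_reduced[OF red(3)] p rr return ad k a by simp
          have "?p \<cdot> ((word_inv r @ [d]) @ r') = k \<cdot> (a' # r')"
            using words.m_assoc[of ?p "word_inv r @ [d]" r'] concat_reduce_reduced[OF red(1)]
              p red(3) a' across split by simp
          then have "proj x (k \<cdot> [a]) = proj x ?p \<or> proj x (k \<cdot> (a' # r')) = proj x (k \<cdot> [a])"
              "proj x (k \<cdot> [a']) = proj x ?p \<or> proj x (k \<cdot> (a' # r')) = proj x (k \<cdot> [a'])"
            using proj_changes_once[OF red(2) p k(2)] proj_changes_once[OF red(1) p k(2)] return across by simp_all
          then show ?thesis
            using outside k p Cons.prems g' by (auto simp: majority proj_in reduced_concat_reduce)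
        qed
      qed
      moreover have "c = [] \<or> source (hd c) = source a"
        using e A by (simp add: c_def)
      ultimately show ?thesis
        using c g' by (intro exI[of _ c]) auto
    qed
  qed
qed

definition word_med where
  "word_med g1 g2 g3 = (SOME c. reduced c \<and> (\<forall>k x. reduced k \<longrightarrow> x \<in> X \<longrightarrow>
    proj x (k \<cdot> c) = m (proj x (k \<cdot> g1)) (proj x (k \<cdot> g2)) (proj x (k \<cdot> g3))))"

lemma word_med:
  assumes "reduced g1" "reduced g2" "reduced g3"
  shows "reduced (word_med g1 g2 g3)"
    and "\<And>k x. \<lbrakk>reduced k; x \<in> X\<rbrakk> \<Longrightarrow>
      proj x (k \<cdot> word_med g1 g2 g3) = m (proj x (k \<cdot> g1)) (proj x (k \<cdot> g2)) (proj x (k \<cdot> g3))"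
proof -
  let ?i = "inv\<^bsub>word_group\<^esub> g1"
  have i: "reduced ?i"
    using words.inv_closed assms by simp
  have red: "reduced (?i \<cdot> g2)" "reduced (?i \<cdot> g3)"
    using i assms reduced_concat_reduce by auto
  obtain c where c: "reduced c" "\<And>k x. \<lbrakk>reduced k; x \<in> X\<rbrakk> \<Longrightarrow>
      m (proj x k) (proj x (k \<cdot> (?i \<cdot> g2))) (proj x (k \<cdot> (?i \<cdot> g3))) = proj x (k \<cdot> c)"
    using median_with_origin[OF red] by blast
  have cancel: "k \<cdot> g1 \<cdot> (?i \<cdot> g) = k \<cdot> g" if "reduced k" "reduced g" for k g
    using that assms i words.m_assoc[of k g1 "?i \<cdot> g"] words.m_assoc[of g1 ?i g]
      words.r_inv[of g1] words.l_one[of g] reduced_concat_reduce by simp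
  have "\<exists>c. reduced c \<and> (\<forall>k x. reduced k \<longrightarrow> x \<in> X \<longrightarrow>
    proj x (k \<cdot> c) = m (proj x (k \<cdot> g1)) (proj x (k \<cdot> g2)) (proj x (k \<cdot> g3)))"
  proof (intro exI[of _ "g1 \<cdot> c"] conjI allI impI)
    fix k x assume "reduced k" "x \<in> X"
    then show "proj x (k \<cdot> (g1 \<cdot> c)) = m (proj x (k \<cdot> g1)) (proj x (k \<cdot> g2)) (proj x (k \<cdot> g3))"
      using c(2)[of "k \<cdot> g1" x] assms cancel c(1) words.m_assoc[of k g1 c] reduced_concat_reduce
      by simp
  qed (use assms c reduced_concat_reduce in blast)
  from someI_ex[OF this] show "reduced (word_med g1 g2 g3)"
    and "\<And>k x. \<lbrakk>reduced k; x \<in> X\<rbrakk> \<Longrightarrow>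
      proj x (k \<cdot> word_med g1 g2 g3) = m (proj x (k \<cdot> g1)) (proj x (k \<cdot> g2)) (proj x (k \<cdot> g3))"
    unfolding word_med_def by blast+
qed

lemma median_group_words: "median_group word_group word_med"
proof -
  have "median_set (carrier word_group) word_med"
  proof (rule median_set_by_coordinates[where C = "{\<lambda>w. proj x (k \<cdot> w) | x k. x \<in> X \<and> reduced k}"])
    show "median_set X m" by (rule median_set_axioms)
    fix u v w assume uv: "u \<in> carrier word_group" "v \<in> carrier word_group"
    show "u = v" if "\<And>f. f \<in> {\<lambda>w. proj x (k \<cdot> w) | x k. x \<in> X \<and> reduced k} \<Longrightarrow> f u = f v"
    proof (rule coordinates_separate)
      fix k x assume "reduced k" "x \<in> X"
      then show "proj x (k \<cdot> u) = proj x (k \<cdot> v)"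
        using that[of "\<lambda>w. proj x (k \<cdot> w)"] by blast
    qed (use uv in simp_all)
    assume w: "w \<in> carrier word_group"
    show "word_med u v w \<in> carrier word_group"
      using uv w word_med by simp
    show "f (word_med u v w) = m (f u) (f v) (f w)"
      if "f \<in> {\<lambda>w. proj x (k \<cdot> w) | x k. x \<in> X \<and> reduced k}" for f
      using that uv w word_med(2) by auto
  qed (auto simp: proj_in reduced_concat_reduce)
  moreover have "g \<cdot> word_med u v w = word_med (g \<cdot> u) (g \<cdot> v) (g \<cdot> w)"
    if "reduced g" "reduced u" "reduced v" "reduced w" for g u v w
  proof (rule coordinates_separate)
    fix k x assume kx: "reduced k" "x \<in> X"
    have *: "k \<cdot> (g \<cdot> l) = k \<cdot> g \<cdot> l" if "reduced l" for l
      using words.m_assoc[of k g l] kx that \<open>reduced g\<close> by simp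
    show "proj x (k \<cdot> (g \<cdot> word_med u v w)) = proj x (k \<cdot> word_med (g \<cdot> u) (g \<cdot> v) (g \<cdot> w))"
      using kx that by (simp add: * word_med reduced_concat_reduce)
  qed (simp_all add: that word_med reduced_concat_reduce)
  ultimately show ?thesis
    by (simp add: median_group_def median_group_axioms_def words.group_axioms)
qed

definition word_of :: "'x \<Rightarrow> 'x \<Rightarrow> ('x, 'h) arrow list"
  where "word_of b x = push (arrow_between b x) []"

lemma word_of:
  assumes "b \<in> X" "x \<in> X"
  shows "reduced (word_of b x)" "proj b (word_of b x) = x"
proof -
  show "reduced (word_of b x)"
    unfolding word_of_def by (rule reduced_push) (use assms arrow_between reduced_Nil in auto)
  show "proj b (word_of b x) = x"
    unfolding word_of_def using proj_push[of b "arrow_between b x" "[]"] assms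
    by (simp add: arrow_between reduced_Nil)
qed

lemma word_of_act:
  assumes "b \<in> X" "h \<in> carrier H" "x \<in> X"
  shows "word_of b (\<phi> h x) = word_of b (\<phi> h b) \<cdot> word_of b x"
proof -
  let ?a = "arrow_between b (\<phi> h b)" and ?e = "arrow_between b x"
  have hb: "\<phi> h b \<in> X" using act_in assms by blast
  have "coeff b \<otimes> (inv (coeff b) \<otimes> coeff x) = coeff x"
    using assms by (simp add: m_assoc[symmetric] coeff_props)
  then have "comp ?a ?e = arrow_between b (\<phi> h x)"
    using assms by (simp add: arrow_between_def rep_act coeff_act coeff_props m_assoc)
  moreover have "push ?a (push ?e []) = push (comp ?a ?e) []"
    by (rule push_push) (use assms hb in \<open>auto simp: arrow_between rep_act reduced_Nil\<close>)
  moreover have "push ?a [] \<cdot> push ?e [] = push ?a (push ?e [])"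
    by (simp add: concat_reduce_def push_unit)
  ultimately show ?thesis
    by (simp only: word_of_def)
qed

text \<open>A coordinate is either constant on the copy formed by the words \<open>word_of b x\<close>, or restricts on
  it to the translation by an element of \<open>H\<close>; both preserve medians.\<close>

lemma word_of_med:
  assumes b: "b \<in> X" and xyz: "x \<in> X" "y \<in> X" "z \<in> X"
  shows "word_of b (m x y z) = word_med (word_of b x) (word_of b y) (word_of b z)"
proof (rule coordinates_separate)
  note q = word_of[OF b]
  fix k u assume k: "reduced k" and u: "u \<in> X"
  consider (inside) v where "v \<in> X" "rep v = rep b" "\<And>w. reduced w \<Longrightarrow> proj u (k \<cdot> w) = proj v w"
    | (outside) "\<And>w. w \<in> X \<Longrightarrow> proj u (k \<cdot> word_of b w) = proj u k"
    using proj_step_or_copy[OF k _ u] arrow_between[OF b] unfolding word_of_def by metis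
  then show "proj u (k \<cdot> word_of b (m x y z)) =
      proj u (k \<cdot> word_med (word_of b x) (word_of b y) (word_of b z))"
  proof cases
    case inside
    let ?h = "coeff v \<otimes> inv coeff b"
    have h: "?h \<in> carrier H"
      using inside b coeff_props by simp
    have "proj v (word_of b w) = \<phi> ?h w" if "w \<in> X" for w
    proof -
      have "proj v (word_of b w) = step v (arrow_between b w)"
        unfolding word_of_def using proj_push[of v "arrow_between b w" "[]"] inside b that
        by (simp add: arrow_between reduced_Nil)
      also have "\<dots> = \<phi> (?h \<otimes> coeff w) (rep w)"
        using inside b that coeff_props by (simp add: arrow_between_def m_assoc)
      also have "\<dots> = \<phi> ?h w"
        using act_mult[OF h, of "coeff w" "rep w"] that coeff_props rep_in by simp
      finally show ?thesis .
    qed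
    then show ?thesis
      using xyz q inside h k u by (simp add: word_med median_closed act_med)
  next
    case outside
    then show ?thesis
      using xyz q k u by (simp add: word_med median_closed majority proj_in)
  qed
qed (simp_all add: word_of b xyz word_med median_closed)

end

text \<open>An element \<open>h\<close> has to go to \<open>word_of b (h b)\<close>, the only word that carries the image of \<open>b\<close>,
  which is empty, to the image of \<open>h b\<close>.\<close>

theorem fams_embeds_in_median_group:
  fixes A :: "('h, 'x) median_action"
  assumes "fams A"
  obtains G :: "('x, 'h) arrow list monoid" and n p\<^sub>0 p where "median_group G n"
    "(p\<^sub>0, p) \<in> fams_hom A (regular_action G n)" "inj_on p (pts A)"
proof -
  interpret free_median_action "grp A" "pts A" "med A" "act A"
    using assms fams_iff by blast
  obtain b where b: "b \<in> pts A" using nonempty by blast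
  have "(\<lambda>h\<in>carrier (grp A). word_of b (act A h b), \<lambda>x\<in>pts A. word_of b x)
      \<in> fams_hom A (regular_action word_group word_med)"
  proof (rule fams_homI)
    show "(\<lambda>h\<in>carrier (grp A). word_of b (act A h b))
        \<in> hom (grp A) (grp (regular_action word_group word_med))"
    proof (rule homI)
      fix g h assume "g \<in> carrier (grp A)" "h \<in> carrier (grp A)"
      then show "(\<lambda>h\<in>carrier (grp A). word_of b (act A h b)) (g \<otimes>\<^bsub>grp A\<^esub> h) =
        (\<lambda>h\<in>carrier (grp A). word_of b (act A h b)) g
          \<otimes>\<^bsub>grp (regular_action word_group word_med)\<^esub>
        (\<lambda>h\<in>carrier (grp A). word_of b (act A h b)) h"
        using b word_of_act[OF b, of g "act A h b"] act_in by (simp add: act_mult)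
    qed (use b word_of act_in in simp)
    fix g x assume "g \<in> carrier (grp A)" "x \<in> pts A"
    then show "(\<lambda>x\<in>pts A. word_of b x) (act A g x) = act (regular_action word_group word_med)
        ((\<lambda>h\<in>carrier (grp A). word_of b (act A h b)) g) ((\<lambda>x\<in>pts A. word_of b x) x)"
      using b word_of act_in word_of_act[OF b, of g x] by simp
  qed (use b word_of word_of_med median_closed in auto)
  moreover have "inj_on (\<lambda>x\<in>pts A. word_of b x) (pts A)"
    by (rule inj_on_inverseI[where g = "proj b"]) (simp add: word_of b)
  ultimately show thesis
    using that median_group_words by blast
qed

section \<open>Transitive actions as median groups\<close>

text \<open>The inverse of the orbit map \<open>g \<mapsto> g y\<^sub>0\<close>. Transporting the median along it turns the
  acting group into a median group.\<close>

definition displacement :: "('g, 'x) median_action \<Rightarrow> 'x \<Rightarrow> 'x \<Rightarrow> 'g"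
  where "displacement K y\<^sub>0 y = (THE g. g \<in> carrier (grp K) \<and> act K g y\<^sub>0 = y)"

definition transported_med :: "('g, 'x) median_action \<Rightarrow> 'x \<Rightarrow> 'g \<Rightarrow> 'g \<Rightarrow> 'g \<Rightarrow> 'g"
  where "transported_med K y\<^sub>0 f g h =
    displacement K y\<^sub>0 (med K (act K f y\<^sub>0) (act K g y\<^sub>0) (act K h y\<^sub>0))"

lemma displacement_eq:
  assumes "fams K" "y\<^sub>0 \<in> pts K" "g \<in> carrier (grp K)"
  shows "displacement K y\<^sub>0 (act K g y\<^sub>0) = g"
proof -
  interpret free_median_action "grp K" "pts K" "med K" "act K"
    using assms(1) fams_iff by blast
  show ?thesis
    unfolding displacement_def using assms act_cancel by blast
qed

lemma displacement:
  assumes "ftams K" "y\<^sub>0 \<in> pts K" "y \<in> pts K"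
  shows "displacement K y\<^sub>0 y \<in> carrier (grp K)" "act K (displacement K y\<^sub>0 y) y\<^sub>0 = y"
proof -
  obtain g where "g \<in> carrier (grp K)" "act K g y\<^sub>0 = y"
    using assms transitive_action.unique_orbit unfolding ftams_def by metis
  then show "displacement K y\<^sub>0 y \<in> carrier (grp K)" "act K (displacement K y\<^sub>0 y) y\<^sub>0 = y"
    using displacement_eq[of K y\<^sub>0 g] assms by (auto simp: ftams_def)
qed

lemma median_group_transported:
  assumes "ftams K" "y\<^sub>0 \<in> pts K"
  shows "median_group (grp K) (transported_med K y\<^sub>0)"
    and "\<And>f g h. \<lbrakk>f \<in> carrier (grp K); g \<in> carrier (grp K); h \<in> carrier (grp K)\<rbrakk> \<Longrightarrow>
      act K (transported_med K y\<^sub>0 f g h) y\<^sub>0 = med K (act K f y\<^sub>0) (act K g y\<^sub>0) (act K h y\<^sub>0)"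
proof -
  interpret free_median_action "grp K" "pts K" "med K" "act K"
    using assms(1) fams_iff unfolding ftams_def by blast
  show act_med': "act K (transported_med K y\<^sub>0 f g h) y\<^sub>0 = med K (act K f y\<^sub>0) (act K g y\<^sub>0) (act K h y\<^sub>0)"
    if "f \<in> carrier (grp K)" "g \<in> carrier (grp K)" "h \<in> carrier (grp K)" for f g h
    unfolding transported_med_def using that assms by (simp add: displacement median_closed act_in)
  have closed: "transported_med K y\<^sub>0 f g h \<in> carrier (grp K)"
    if "f \<in> carrier (grp K)" "g \<in> carrier (grp K)" "h \<in> carrier (grp K)" for f g h
    unfolding transported_med_def using that assms by (simp add: displacement median_closed act_in)
  have "median_set (carrier (grp K)) (transported_med K y\<^sub>0)"
    by (rule median_set_by_coordinates[where C = "{\<lambda>g. act K g y\<^sub>0}" and m = "med K"])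
      (use assms(2) act_in closed act_med' act_cancel median_set_axioms in auto)
  moreover have "g \<otimes>\<^bsub>grp K\<^esub> transported_med K y\<^sub>0 e f h =
      transported_med K y\<^sub>0 (g \<otimes>\<^bsub>grp K\<^esub> e) (g \<otimes>\<^bsub>grp K\<^esub> f) (g \<otimes>\<^bsub>grp K\<^esub> h)"
    if "g \<in> carrier (grp K)" "e \<in> carrier (grp K)" "f \<in> carrier (grp K)" "h \<in> carrier (grp K)" for g e f h
    by (rule act_cancel[of _ _ y\<^sub>0])
      (use that assms(2) closed in \<open>simp_all add: act_mult act_med' act_med act_in\<close>)
  ultimately show "median_group (grp K) (transported_med K y\<^sub>0)"
    by (simp add: median_group_def median_group_axioms_def is_group)
qed

section \<open>The universal median group of a free action\<close>

datatype 'x tm =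
    Gen 'x | One | Mul "'x tm" "'x tm" | Inv "'x tm" | Med "'x tm" "'x tm" "'x tm"

text \<open>The presentation of the envelope: the least congruence that contains the laws of median groups
  and the relations between the generators. Identifying the generators outside of \<open>X\<close> with the
  identity makes every term meaningful, so that no side conditions on terms are needed.\<close>

inductive tm_eq :: "('h, 'x) median_action \<Rightarrow> 'x \<Rightarrow> 'x tm \<Rightarrow> 'x tm \<Rightarrow> bool"
  for A b where
  refl: "tm_eq A b t t"
| sym: "tm_eq A b s t \<Longrightarrow> tm_eq A b t s"
| trans: "\<lbrakk>tm_eq A b s t; tm_eq A b t u\<rbrakk> \<Longrightarrow> tm_eq A b s u"
| Mul_cong: "\<lbrakk>tm_eq A b s s'; tm_eq A b t t'\<rbrakk> \<Longrightarrow> tm_eq A b (Mul s t) (Mul s' t')"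
| Inv_cong: "tm_eq A b s s' \<Longrightarrow> tm_eq A b (Inv s) (Inv s')"
| Med_cong: "\<lbrakk>tm_eq A b s s'; tm_eq A b t t'; tm_eq A b u u'\<rbrakk>
    \<Longrightarrow> tm_eq A b (Med s t u) (Med s' t' u')"
| assoc: "tm_eq A b (Mul (Mul s t) u) (Mul s (Mul t u))"
| l_one: "tm_eq A b (Mul One t) t"
| l_inv: "tm_eq A b (Mul (Inv t) t) One"
| Med_left: "tm_eq A b (Med s t u) (Med t s u)"
| Med_right: "tm_eq A b (Med s t u) (Med s u t)"
| Med_majority: "tm_eq A b (Med s t s) s"
| Med_distrib: "tm_eq A b (Med (Med s t u) v w) (Med (Med s v w) (Med t v w) u)"
| Med_translate: "tm_eq A b (Mul s (Med t u v)) (Med (Mul s t) (Mul s u) (Mul s v))"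
| Gen_outside: "x \<notin> pts A \<Longrightarrow> tm_eq A b (Gen x) One"
| Gen_base: "tm_eq A b (Gen b) One"
| Gen_act: "\<lbrakk>h \<in> carrier (grp A); x \<in> pts A\<rbrakk>
    \<Longrightarrow> tm_eq A b (Gen (act A h x)) (Mul (Gen (act A h b)) (Gen x))"
| Gen_med: "\<lbrakk>x \<in> pts A; y \<in> pts A; z \<in> pts A\<rbrakk>
    \<Longrightarrow> tm_eq A b (Gen (med A x y z)) (Med (Gen x) (Gen y) (Gen z))"

text \<open>Terms in Polish notation. Each symbol determines its number of arguments, which makes the code
  prefix-free and hence injective.\<close>

primrec encode :: "'x tm \<Rightarrow> ('h, 'x) universe" where
  "encode (Gen x) = [Inr (Inl x)]"
| "encode One = [Inr (Inr 0)]"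
| "encode (Mul s t) = Inr (Inr 1) # encode s @ encode t"
| "encode (Inv s) = Inr (Inr 2) # encode s"
| "encode (Med s t u) = Inr (Inr 3) # encode s @ encode t @ encode u"

lemma encode_prefix_free: "encode s @ u = encode t @ v \<Longrightarrow> s = t \<and> u = v"
proof (induction s arbitrary: t u v)
  case (Gen x)
  then show ?case by (cases t) auto
next
  case One
  then show ?case by (cases t) auto
next
  case (Mul s1 s2)
  show ?case
  proof (cases t)
    case t: (Mul t1 t2)
    have "s1 = t1 \<and> encode s2 @ u = encode t2 @ v"
      by (rule Mul.IH(1)) (use Mul.prems t in simp)
    then show ?thesis
      using Mul.IH(2)[of u t2 v] t by simp
  qed (use Mul.prems in simp_all)
next
  case (Inv s)
  then show ?case by (cases t) auto
next
  case (Med s1 s2 s3)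
  show ?case
  proof (cases t)
    case t: (Med t1 t2 t3)
    have "s1 = t1 \<and> encode s2 @ encode s3 @ u = encode t2 @ encode t3 @ v"
      by (rule Med.IH(1)) (use Med.prems t in simp)
    moreover from this have "s2 = t2 \<and> encode s3 @ u = encode t3 @ v"
      by (intro Med.IH(2)) simp
    ultimately show ?thesis
      using Med.IH(3)[of u t3 v] t by simp
  qed (use Med.prems in simp_all)
qed

lemma inj_encode: "inj encode"
  by (rule injI) (use encode_prefix_free[of _ "[]" _ "[]"] in auto)

definition decode :: "('h, 'x) universe \<Rightarrow> 'x tm"
  where "decode = inv_into UNIV encode"

lemma decode_encode: "decode (encode t) = t"
  by (simp add: decode_def inj_encode)

text \<open>Equivalent terms satisfy the same predicate under the choice operator, hence have equal codes:
  \<open>nf A b t\<close> names the class of \<open>t\<close> by one of its elements.\<close>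

definition nf :: "('h, 'x) median_action \<Rightarrow> 'x \<Rightarrow> 'x tm \<Rightarrow> ('h, 'x) universe"
  where "nf A b t = encode (SOME s. tm_eq A b t s)"

lemma decode_nf: "tm_eq A b (decode (nf A b t)) t"
  unfolding nf_def decode_encode by (rule tm_eq.sym, rule someI) (rule tm_eq.refl)

lemma nf_eq_iff: "nf A b s = nf A b t \<longleftrightarrow> tm_eq A b s t"
proof
  assume "nf A b s = nf A b t"
  then have "tm_eq A b (decode (nf A b s)) t"
    by (simp add: decode_nf)
  with tm_eq.sym[OF decode_nf] show "tm_eq A b s t"
    by (rule tm_eq.trans)
next
  assume "tm_eq A b s t"
  then have "tm_eq A b s u \<longleftrightarrow> tm_eq A b t u" for u
    by (blast intro: tm_eq.sym tm_eq.trans)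
  then show "nf A b s = nf A b t"
    by (simp add: nf_def)
qed

definition envelope_group :: "('h, 'x) median_action \<Rightarrow> 'x \<Rightarrow> ('h, 'x) universe monoid"
  where "envelope_group A b = \<lparr>carrier = range (nf A b),
    mult = (\<lambda>u v. nf A b (Mul (decode u) (decode v))), one = nf A b One\<rparr>"

definition envelope_med where
  "envelope_med A b u v w = nf A b (Med (decode u) (decode v) (decode w))"

definition envelope :: "('h, 'x) median_action \<Rightarrow> 'x \<Rightarrow> (('h, 'x) universe, ('h, 'x) universe) median_action"
  where "envelope A b = regular_action (envelope_group A b) (envelope_med A b)"

definition envelope_unit ::
  "('h, 'x) median_action \<Rightarrow> 'x \<Rightarrow> ('h \<Rightarrow> ('h, 'x) universe) \<times> ('x \<Rightarrow> ('h, 'x) universe)"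
  where "envelope_unit A b =
    (\<lambda>h\<in>carrier (grp A). nf A b (Gen (act A h b)), \<lambda>x\<in>pts A. nf A b (Gen x))"

lemma envelope_simps:
  "carrier (envelope_group A b) = range (nf A b)"
  "nf A b t \<in> range (nf A b)"
  "one (envelope_group A b) = nf A b One"
  "mult (envelope_group A b) (nf A b s) (nf A b t) = nf A b (Mul s t)"
  "envelope_med A b (nf A b s) (nf A b t) (nf A b u) = nf A b (Med s t u)"
  by (simp_all add: rangeI envelope_group_def envelope_med_def nf_eq_iff tm_eq.Mul_cong
      tm_eq.Med_cong decode_nf)

lemma median_group_envelope: "median_group (envelope_group A b) (envelope_med A b)"
proof -
  have "group (envelope_group A b)"
  proof (rule groupI)
    fix u assume "u \<in> carrier (envelope_group A b)"
    then obtain t where "u = nf A b t" by (auto simp: envelope_simps)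
    then show "\<exists>v\<in>carrier (envelope_group A b). v \<otimes>\<^bsub>envelope_group A b\<^esub> u = \<one>\<^bsub>envelope_group A b\<^esub>"
      by (intro bexI[of _ "nf A b (Inv t)"]) (auto simp: envelope_simps nf_eq_iff tm_eq.l_inv)
  qed (auto simp: envelope_simps nf_eq_iff intro: rangeI tm_eq.assoc tm_eq.l_one)
  moreover have "median_set (carrier (envelope_group A b)) (envelope_med A b)"
    by unfold_locales
      (auto simp: envelope_simps nf_eq_iff intro: rangeI tm_eq.Med_left tm_eq.Med_right tm_eq.Med_majority
        tm_eq.Med_distrib)
  moreover have "median_group_axioms (envelope_group A b) (envelope_med A b)"
    by unfold_locales (auto simp: envelope_simps nf_eq_iff intro: rangeI tm_eq.Med_translate)
  ultimately show ?thesis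
    by (simp add: median_group_def)
qed

lemma inv_envelope: "inv\<^bsub>envelope_group A b\<^esub> (nf A b t) = nf A b (Inv t)"
proof -
  interpret median_group "envelope_group A b" "envelope_med A b"
    by (rule median_group_envelope)
  show ?thesis
    by (rule inv_equality) (auto simp: envelope_simps nf_eq_iff tm_eq.l_inv)
qed

lemma ftams_envelope: "ftams (envelope A b)"
  unfolding envelope_def by (rule ftams_regular_action) (rule median_group_envelope)

lemma envelope_unit_in:
  assumes "fams A" "b \<in> pts A"
  shows "envelope_unit A b \<in> fams_hom A (envelope A b)"
proof -
  interpret free_median_action "grp A" "pts A" "med A" "act A"
    using assms(1) fams_iff by blast
  show ?thesis
    unfolding envelope_unit_def
  proof (rule fams_homI)
    show "(\<lambda>h\<in>carrier (grp A). nf A b (Gen (act A h b))) \<in> hom (grp A) (grp (envelope A b))"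
      by (rule homI)
        (auto simp: envelope_def envelope_simps nf_eq_iff act_mult act_in assms intro: rangeI tm_eq.Gen_act)
  qed (auto simp: envelope_def envelope_simps nf_eq_iff act_in median_closed assms
      intro: rangeI tm_eq.Gen_act tm_eq.Gen_med)
qed

primrec eval :: "'g monoid \<Rightarrow> ('g \<Rightarrow> 'g \<Rightarrow> 'g \<Rightarrow> 'g) \<Rightarrow> ('x \<Rightarrow> 'g) \<Rightarrow> 'x tm \<Rightarrow> 'g" where
  "eval G n q (Gen x) = q x"
| "eval G n q One = \<one>\<^bsub>G\<^esub>"
| "eval G n q (Mul s t) = eval G n q s \<otimes>\<^bsub>G\<^esub> eval G n q t"
| "eval G n q (Inv s) = inv\<^bsub>G\<^esub> eval G n q s"
| "eval G n q (Med s t u) = n (eval G n q s) (eval G n q t) (eval G n q u)"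

lemma eval_closed:
  assumes "median_group G n" "\<And>x. q x \<in> carrier G"
  shows "eval G n q t \<in> carrier G"
proof -
  interpret median_group G n by fact
  show ?thesis
    by (induction t) (auto simp: assms(2) median_closed)
qed

lemma eval_respects:
  assumes "median_group G n" "\<And>x. q x \<in> carrier G"
    and "\<And>x. x \<notin> pts A \<Longrightarrow> q x = \<one>\<^bsub>G\<^esub>" "q b = \<one>\<^bsub>G\<^esub>"
    and "\<And>h x. \<lbrakk>h \<in> carrier (grp A); x \<in> pts A\<rbrakk> \<Longrightarrow> q (act A h x) = q (act A h b) \<otimes>\<^bsub>G\<^esub> q x"
    and "\<And>x y z. \<lbrakk>x \<in> pts A; y \<in> pts A; z \<in> pts A\<rbrakk> \<Longrightarrow> q (med A x y z) = n (q x) (q y) (q z)"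
    and "tm_eq A b s t"
  shows "eval G n q s = eval G n q t"
proof -
  interpret median_group G n by fact
  note closed = eval_closed[of G n q, OF assms(1,2)]
  show ?thesis
    using assms(7)
  proof induction
    case (Med_distrib s t u v w)
    show ?case using M3 closed by simp
  next
    case (Med_left s t u)
    show ?case using M1_left closed by simp
  next
    case (Med_right s t u)
    show ?case using M1_right closed by simp
  qed (simp_all add: closed assms(3-6) m_assoc M2 left_invariant)
qed

text \<open>Given a morphism \<open>p\<close>, the target is identified with its own group by means of the base point
  \<open>y = p b\<close>, and terms are evaluated there on the displacements of the points \<open>p x\<close>. Uniqueness
  holds because a morphism from the envelope is determined on points by its group component and
  the image of the identity, and then on terms by induction; for a median term the value of the
  group component is recovered from the point component by freeness.\<close>

lemma tup_envelope_unit: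
  assumes A: "fams A" and b: "b \<in> pts A" and K: "ftams K"
  shows "tup A (envelope A b) (envelope_unit A b) K"
  unfolding tup_iff
proof
  interpret A: free_median_action "grp A" "pts A" "med A" "act A"
    using A fams_iff by blast
  interpret K: free_median_action "grp K" "pts K" "med K" "act K"
    using K fams_iff unfolding ftams_def by blast
  fix p assume "p \<in> fams_hom A K"
  moreover obtain p\<^sub>0 p\<^sub>1 where p_eq: "p = (p\<^sub>0, p\<^sub>1)" by (cases p)
  ultimately have p: "(p\<^sub>0, p\<^sub>1) \<in> fams_hom A K" by simp
  note hom = fams_homD[OF p] fams_homD'[OF p]
  define y where "y = p\<^sub>1 b"
  have y: "y \<in> pts K"
    using hom b by (simp add: y_def)
  let ?G = "grp K" and ?n = "transported_med K y"
  define q where "q x = (if x \<in> pts A then displacement K y (p\<^sub>1 x) else \<one>\<^bsub>?G\<^esub>)" for x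
  have q: "q x \<in> carrier ?G" for x
    using hom y K by (simp add: q_def displacement)
  have q_y: "act K (q x) y = p\<^sub>1 x" if "x \<in> pts A" for x
    using hom y K that by (simp add: q_def displacement)
  have q_b: "q b = \<one>\<^bsub>?G\<^esub>"
    using q_y[OF b] q y K.free by (simp add: y_def)
  have q_act_base: "q (act A h b) = p\<^sub>0 h" if "h \<in> carrier (grp A)" for h
    by (rule K.act_cancel[of _ _ y]) (use that b y q A.act_in q_y hom in \<open>simp_all add: y_def\<close>)
  have q_act: "q (act A h x) = q (act A h b) \<otimes>\<^bsub>?G\<^esub> q x"
    if "h \<in> carrier (grp A)" "x \<in> pts A" for h x
    by (rule K.act_cancel[of _ _ y])
      (use that y q A.act_in q_y hom q_act_base in \<open>simp_all add: K.act_mult\<close>)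
  have q_med: "q (med A x z w) = ?n (q x) (q z) (q w)"
    if "x \<in> pts A" "z \<in> pts A" "w \<in> pts A" for x z w
  proof (rule K.act_cancel[of _ _ y])
    interpret G: median_group ?G ?n
      by (rule median_group_transported[OF K y])
    show "?n (q x) (q z) (q w) \<in> carrier ?G"
      using q G.median_closed by blast
    show "act K (q (med A x z w)) y = act K (?n (q x) (q z) (q w)) y"
      using that q q_y hom A.median_closed by (simp add: median_group_transported(2)[OF K y])
  qed (use q y in auto)
  note group = median_group_transported(1)[OF K y]
  let ?ev = "eval ?G ?n q"
  have ev: "?ev t \<in> carrier ?G" for t
    by (rule eval_closed[OF group q])
  have ev_nf: "?ev (decode (nf A b t)) = ?ev t" for t
    by (rule eval_respects[where A = A and b = b and q = q, OF group q _ q_b q_act q_med decode_nf])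
      (simp_all add: q_def)
  define P\<^sub>0 where "P\<^sub>0 = (\<lambda>w\<in>range (nf A b). ?ev (decode w))"
  define P\<^sub>1 where "P\<^sub>1 = (\<lambda>w\<in>range (nf A b). act K (?ev (decode w)) y)"
  have P\<^sub>0_nf: "P\<^sub>0 (nf A b t) = ?ev t" and P\<^sub>1_nf: "P\<^sub>1 (nf A b t) = act K (?ev t) y" for t
    by (simp_all add: P\<^sub>0_def P\<^sub>1_def ev_nf rangeI)
  have P_hom: "(P\<^sub>0, P\<^sub>1) \<in> fams_hom (envelope A b) K"
  proof (rule fams_homI)
    show "P\<^sub>0 \<in> hom (grp (envelope A b)) (grp K)"
    proof (rule homI)
      fix u v assume "u \<in> carrier (grp (envelope A b))" "v \<in> carrier (grp (envelope A b))"
      then obtain s t where "u = nf A b s" "v = nf A b t"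
        by (auto simp: envelope_def envelope_simps)
      then show "P\<^sub>0 u \<in> carrier (grp K)"
          "P\<^sub>0 (u \<otimes>\<^bsub>grp (envelope A b)\<^esub> v) = P\<^sub>0 u \<otimes>\<^bsub>grp K\<^esub> P\<^sub>0 v"
        by (simp_all add: envelope_def envelope_simps P\<^sub>0_nf ev)
    qed
  next
    fix u v w
    assume "u \<in> pts (envelope A b)" "v \<in> pts (envelope A b)" "w \<in> pts (envelope A b)"
    then obtain r s t where "u = nf A b r" "v = nf A b s" "w = nf A b t"
      by (auto simp: envelope_def envelope_simps)
    then show "P\<^sub>1 (med (envelope A b) u v w) = med K (P\<^sub>1 u) (P\<^sub>1 v) (P\<^sub>1 w)"
      by (simp add: envelope_def envelope_simps P\<^sub>1_nf ev median_group_transported(2)[OF K y])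
  next
    fix u v
    assume "u \<in> carrier (grp (envelope A b))" "v \<in> pts (envelope A b)"
    then obtain s t where "u = nf A b s" "v = nf A b t"
      by (auto simp: envelope_def envelope_simps)
    then show "P\<^sub>1 (act (envelope A b) u v) = act K (P\<^sub>0 u) (P\<^sub>1 v)"
      by (simp add: envelope_def envelope_simps P\<^sub>0_nf P\<^sub>1_nf ev K.act_mult y)
  qed (auto simp: envelope_def envelope_simps P\<^sub>0_def P\<^sub>1_def ev K.act_in y)
  have P_unit: "fams_comp A (P\<^sub>0, P\<^sub>1) (envelope_unit A b) = p"
  proof -
    have "compose (carrier (grp A)) P\<^sub>0 (fst (envelope_unit A b)) = p\<^sub>0"
      by (rule extensionalityI[of _ "carrier (grp A)"])
        (simp_all add: envelope_unit_def compose_eq P\<^sub>0_nf q_act_base hom(2))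
    moreover have "compose (pts A) P\<^sub>1 (snd (envelope_unit A b)) = p\<^sub>1"
      by (rule extensionalityI[of _ "pts A"])
        (simp_all add: envelope_unit_def compose_eq P\<^sub>1_nf q_y hom(4))
    ultimately show ?thesis
      by (simp add: fams_comp_def p_eq)
  qed
  have unique: "R = (P\<^sub>0, P\<^sub>1)" if "R \<in> fams_hom (envelope A b) K" "fams_comp A R (envelope_unit A b) = p" for R
  proof -
    obtain R\<^sub>0 R\<^sub>1 where R_eq: "R = (R\<^sub>0, R\<^sub>1)" by (cases R)
    have R: "(R\<^sub>0, R\<^sub>1) \<in> fams_hom (envelope A b) K"
      using that R_eq by simp
    note Rh = fams_homD[OF R] fams_homD'[OF R]
    have nf_in: "nf A b t \<in> carrier (grp (envelope A b))" "nf A b t \<in> pts (envelope A b)" for t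
      by (auto simp: envelope_def envelope_simps)
    have R_Gen: "R\<^sub>1 (nf A b (Gen x)) = p\<^sub>1 x" if "x \<in> pts A" for x
    proof -
      have "compose (pts A) R\<^sub>1 (snd (envelope_unit A b)) x = p\<^sub>1 x"
        using \<open>fams_comp A R (envelope_unit A b) = p\<close> by (simp add: fams_comp_def p_eq R_eq)
      then show ?thesis
        using that by (simp add: compose_eq envelope_unit_def)
    qed
    have "nf A b (Gen b) = nf A b One"
      by (simp add: nf_eq_iff tm_eq.Gen_base)
    then have R_One: "R\<^sub>1 (nf A b One) = y"
      using R_Gen[OF b] by (simp add: y_def)
    have R\<^sub>1_eq: "R\<^sub>1 (nf A b t) = act K (R\<^sub>0 (nf A b t)) y" for t
    proof -
      have "act (envelope A b) (nf A b t) (nf A b One) = nf A b t"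
        using group.is_monoid[of "envelope_group A b"] median_group_envelope[of A b]
          monoid.r_one[of "envelope_group A b" "nf A b t"]
        by (simp add: median_group_def envelope_def envelope_simps)
      then show ?thesis
        using Rh(6)[OF nf_in(1) nf_in(2), of t One] R_One by simp
    qed
    have R\<^sub>0_in: "R\<^sub>0 (nf A b t) \<in> carrier ?G" for t
      using Rh(7) nf_in by blast
    have R\<^sub>0_hom: "group_hom (envelope_group A b) ?G R\<^sub>0"
      using Rh(1) median_group_envelope[of A b] K.is_group
      by (simp add: group_hom_def group_hom_axioms_def median_group_def envelope_def)
    have "R\<^sub>0 (nf A b t) = ?ev t" for t
    proof (induction t)
      case (Gen x)
      show ?case
      proof (cases "x \<in> pts A")
        case True
        then show ?thesis
          using R\<^sub>1_eq[of "Gen x"] R_Gen q_y q R\<^sub>0_in y K.act_cancel by simp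
      next
        case False
        then have "nf A b (Gen x) = nf A b One"
          by (simp add: nf_eq_iff tm_eq.Gen_outside)
        then show ?thesis
          using False group_hom.hom_one[OF R\<^sub>0_hom] by (simp add: q_def envelope_simps)
      qed
    next
      case One
      then show ?case
        using group_hom.hom_one[OF R\<^sub>0_hom] by (simp add: envelope_simps)
    next
      case (Mul s t)
      then show ?case
        using group_hom.hom_mult[OF R\<^sub>0_hom, of "nf A b s" "nf A b t"] by (simp add: envelope_simps)
    next
      case (Inv t)
      then show ?case
        using group_hom.hom_inv[OF R\<^sub>0_hom, of "nf A b t"] by (simp add: envelope_simps inv_envelope)
    next
      case (Med s t u)
      have "act K (R\<^sub>0 (nf A b (Med s t u))) y = R\<^sub>1 (nf A b (Med s t u))"
        by (simp add: R\<^sub>1_eq)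
      also have "\<dots> = med K (R\<^sub>1 (nf A b s)) (R\<^sub>1 (nf A b t)) (R\<^sub>1 (nf A b u))"
        using Rh(5)[OF nf_in(2) nf_in(2) nf_in(2), of s t u] by (simp add: envelope_def envelope_simps)
      also have "\<dots> = act K (?ev (Med s t u)) y"
        using Med by (simp add: R\<^sub>1_eq median_group_transported(2)[OF K y] ev)
      finally show ?case
        using K.act_cancel R\<^sub>0_in ev y by blast
    qed
    then have "R\<^sub>0 w = P\<^sub>0 w" "R\<^sub>1 w = P\<^sub>1 w" if "w \<in> range (nf A b)" for w
      using that R\<^sub>1_eq P\<^sub>0_nf P\<^sub>1_nf by auto
    then have "R\<^sub>0 = P\<^sub>0" "R\<^sub>1 = P\<^sub>1"
      using Rh(2,4) fams_homD(2,4)[OF P_hom]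
      by (auto simp: envelope_def envelope_simps intro: extensionalityI)
    then show ?thesis
      by (simp add: R_eq)
  qed
  show "\<exists>!P. P \<in> fams_hom (envelope A b) K \<and> fams_comp A P (envelope_unit A b) = p"
    using P_hom P_unit unique by blast
qed

text \<open>The embedding into the group of words factors through the envelope, so the unit is injective
  on points. It is injective on the group because \<open>H\<close> acts freely: distinct elements move \<open>b\<close> to
  distinct points.\<close>

lemma fams_embedding_envelope:
  assumes A: "fams A" and b: "b \<in> pts A"
  shows "fams_embedding A (envelope A b) (envelope_unit A b)"
proof -
  interpret free_median_action "grp A" "pts A" "med A" "act A"
    using A fams_iff by blast
  obtain G :: "('b, 'a) arrow list monoid" and n p\<^sub>0 p where G: "median_group G n"
    "(p\<^sub>0, p) \<in> fams_hom A (regular_action G n)" "inj_on p (pts A)"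
    using fams_embeds_in_median_group[OF A] by blast
  obtain P where "fams_comp A P (envelope_unit A b) = (p\<^sub>0, p)"
    using tup_envelope_unit[OF A b ftams_regular_action[OF G(1)]] G(2) unfolding tup_iff by blast
  then have "p = compose (pts A) (snd P) (snd (envelope_unit A b))"
    by (simp add: fams_comp_def)
  then have "p x = snd P (nf A b (Gen x))" if "x \<in> pts A" for x
    using that by (simp add: compose_eq envelope_unit_def)
  then have inj: "x = y" if "nf A b (Gen x) = nf A b (Gen y)" "x \<in> pts A" "y \<in> pts A" for x y
    using that G(3) by (metis inj_onD)
  moreover have "g = h" if "nf A b (Gen (act A g b)) = nf A b (Gen (act A h b))"
      "g \<in> carrier (grp A)" "h \<in> carrier (grp A)" for g h
    using inj[OF that(1)] that b act_in act_cancel by blast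
  ultimately show ?thesis
    using envelope_unit_in[OF A b]
    by (auto simp: fams_embedding_def envelope_unit_def inj_on_def)
qed

theorem theorem3:
  fixes A :: "('h, 'x) median_action"
  assumes "fams A"
  shows "(\<exists>W i. tup_envelope A W i) \<and>
    (\<forall>W i. tup_envelope A W i \<longrightarrow>
      (\<forall>K :: ('k, 'y) median_action. ftams K \<longrightarrow> tup A W i K))"
proof -
  obtain b where b: "b \<in> pts A"
    using assms unfolding fams_def by blast
  let ?W = "envelope A b" and ?i = "envelope_unit A b"
  have W: "ftams ?W" "fams ?W"
    using ftams_envelope[of A b] by (simp_all add: ftams_def)
  have "tup A ?W ?i K" if "ftams K"
    for K :: "(('h, 'x) universe, ('h, 'x) universe) median_action"
    using tup_envelope_unit[OF assms b that] .
  then have "tup_envelope A ?W ?i"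
    using W fams_embedding_envelope[OF assms b] by (simp add: tup_envelope_def)
  moreover have "tup A V j K"
    if V: "tup_envelope A V j" and K: "ftams K" for V j and K :: "('k, 'y) median_action"
  proof (rule tup_transfer[of A ?W V ?i j K])
    show "fams V" "j \<in> fams_hom A V" "tup A V j ?W" "tup A V j V"
      using V W by (auto simp: tup_envelope_def ftams_def fams_embedding_def)
    then show "tup A ?W ?i V" "tup A ?W ?i K"
      using tup_envelope_unit[OF assms b] K V by (auto simp: tup_envelope_def)
  qed (use assms W envelope_unit_in[OF assms b] in auto)
  ultimately show ?thesis by blast
qed

end
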